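(* For any integer $d\geq 4$, there is an extreme ray $\mathbb{R}_+\ell$ of $\Sigma_{2d}^\vee$ such that $B_\ell$ has corank $4$, and such that the Hilbert function of the ideal $I(\ell)$ satisfies $\operatorname{Hilb}(I(\ell),j)=\binom{j+2}{2}$ for $0\leq j<d$ and $\operatorname{Hilb}(I(\ell),d)=\binom{d+2}{2}-4$.
   Context: For a field $k\in\{\mathbb{R},\mathbb{C}\}$, $k[x,y,z]_m$ is the vector space of forms of degree $m$ in three variables. $\Sigma_{2d}\subset\mathbb{R}[x,y,z]_{2d}$ is the convex cone of sums of squares of forms of degree $d$. For $\ell\in\mathbb{R}[x,y,z]_{2d}^\ast$, $B_\ell$ is the symmetric bilinear form $(f,g)\mapsto\ell(fg)$ on $\mathbb{R}[x,y,z]_d$; its corank is $\binom{d+2}{2}-\operatorname{rk}B_\ell$. The dual cone is $\Sigma_{2d}^\vee=\{\ell\in\mathbb{R}[x,y,z]_{2d}^\ast : B_\ell\text{ is positive semidefinite}\}$; an extreme ray is a one-dimensional face $\mathbb{R}_+\ell$. For nonzero $\ell\in\mathbb{C}[x,y,z]_m^\ast$ (a real functional is extended complex-linearly), the Gorenstein ideal with socle $\ell$ is the homogeneous ideal $I(\ell)\subset\mathbb{C}[x,y,z]$ generated by all forms $p$ of degree $k$ such that $k>m$ or $\ell(pq)=0$ for all $q\in\mathbb{C}[x,y,z]_{m-k}$. The Hilbert function of a homogeneous ideal $I$ is $\operatorname{Hilb}(I,i)=\dim_{\mathbb{C}}(\mathbb{C}[x,y,z]/I)_i$. *)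

theory Defs
  imports
    "HOL-Analysis.Analysis"
    "HOL-Library.Poly_Mapping"
    "HOL-Library.Function_Algebras"
begin

text \<open>
  Polynomials in \<open>x, y, z\<close> over \<open>'k\<close> are finitely supported maps from exponent triples to
  coefficients, with the convolution product of \<^theory>\<open>HOL-Library.Poly_Mapping\<close>.
\<close>

type_synonym 'k poly3 = "(nat \<times> nat \<times> nat) \<Rightarrow>\<^sub>0 'k"

definition forms :: "nat \<Rightarrow> 'k::zero poly3 set" where
  "forms m = {p. \<forall>(a, b, c) \<in> Poly_Mapping.keys p. a + b + c = m}"

definition smul :: "'k::comm_ring_1 \<Rightarrow> 'k poly3 \<Rightarrow> 'k poly3" where
  "smul c p = Poly_Mapping.single 0 c * p"

text \<open>
  The pointwise real vector space structure on functions (the additive part is that of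
  \<^theory>\<open>HOL-Library.Function_Algebras\<close>); it makes \<^const>\<open>face_of\<close> and \<^const>\<open>dim\<close>
  available for functionals.
\<close>

instantiation "fun" :: (type, real_vector) real_vector
begin

definition scaleR_fun :: "real \<Rightarrow> ('a \<Rightarrow> 'b) \<Rightarrow> 'a \<Rightarrow> 'b" where
  "scaleR_fun c f = (\<lambda>x. c *\<^sub>R f x)"

instance
  by standard (auto simp: scaleR_fun_def fun_eq_iff scaleR_add_right scaleR_add_left)

end

text \<open>
  A functional on \<open>\<real>[x,y,z]\<^sub>m\<close> is encoded as a function on all polynomials that is linear on
  the forms of degree \<open>m\<close> and takes the value 0 elsewhere, so that equality of functions is
  equality of functionals.
\<close>

definition form_dual :: "nat \<Rightarrow> (real poly3 \<Rightarrow> real) set" where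
  "form_dual m = {l.
     (\<forall>p\<in>forms m. \<forall>q\<in>forms m. l (p + q) = l p + l q) \<and>
     (\<forall>c. \<forall>p\<in>forms m. l (smul c p) = c * l p) \<and>
     (\<forall>p. p \<notin> forms m \<longrightarrow> l p = 0)}"

definition bilin :: "(real poly3 \<Rightarrow> real) \<Rightarrow> real poly3 \<Rightarrow> real poly3 \<Rightarrow> real" where
  "bilin l f g = l (f * g)"

definition sos_dual :: "nat \<Rightarrow> (real poly3 \<Rightarrow> real) set" where
  "sos_dual d = {l \<in> form_dual (2 * d). \<forall>f\<in>forms d. bilin l f f \<ge> 0}"

text \<open>
  The rank of a bilinear form \<open>B\<close> on \<open>\<real>[x,y,z]\<^sub>d\<close> is the dimension of the image of the induced
  map \<open>f \<mapsto> B(f, \<cdot>)\<close> into the dual space.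
\<close>

definition bilin_rank :: "nat \<Rightarrow> (real poly3 \<Rightarrow> real poly3 \<Rightarrow> real) \<Rightarrow> nat" where
  "bilin_rank d B = dim ((\<lambda>f g. if g \<in> forms d then B f g else 0) ` forms d)"

definition corank :: "nat \<Rightarrow> (real poly3 \<Rightarrow> real) \<Rightarrow> nat" where
  "corank d l = ((d + 2) choose 2) - bilin_rank d (bilin l)"

definition ray :: "'v::real_vector \<Rightarrow> 'v set" where
  "ray v = {c *\<^sub>R v | c. c \<ge> 0}"

definition spans_extreme_ray :: "'v::real_vector \<Rightarrow> 'v set \<Rightarrow> bool" where
  "spans_extreme_ray v C \<longleftrightarrow> v \<noteq> 0 \<and> ray v face_of C"

definition complexify :: "(real poly3 \<Rightarrow> real) \<Rightarrow> complex poly3 \<Rightarrow> complex" where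
  "complexify l p =
     Complex (l (Poly_Mapping.map Re p)) (l (Poly_Mapping.map Im p))"

text \<open>\<^term>\<open>module.span (*) S\<close> is the ideal of the polynomial ring generated by \<open>S\<close>.\<close>

definition gorenstein_ideal :: "nat \<Rightarrow> (complex poly3 \<Rightarrow> complex) \<Rightarrow> complex poly3 set" where
  "gorenstein_ideal m L = module.span (*)
     {p. \<exists>k. p \<in> forms k \<and> (k > m \<or> (\<forall>q\<in>forms (m - k). L (p * q) = 0))}"

text \<open>
  The residue classes of the elements of \<open>B\<close> are pairwise distinct and form a basis of the
  degree \<open>i\<close> part of \<open>\<complex>[x,y,z]/I\<close>.
\<close>

definition quotient_basis :: "complex poly3 set \<Rightarrow> nat \<Rightarrow> complex poly3 set \<Rightarrow> bool" where
  "quotient_basis I i B \<longleftrightarrow> B \<subseteq> forms i \<and> finite B \<and>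
     (\<forall>c. (\<Sum>b\<in>B. smul (c b) b) \<in> I \<longrightarrow> (\<forall>b\<in>B. c b = 0)) \<and>
     (\<forall>p\<in>forms i. \<exists>c. p - (\<Sum>b\<in>B. smul (c b) b) \<in> I)"

definition Hilb :: "complex poly3 set \<Rightarrow> nat \<Rightarrow> nat" where
  "Hilb I i = (THE n. \<exists>B. quotient_basis I i B \<and> card B = n)"

end

theory Submission
  imports Defs
begin

text \<open>
  Let \<open>X = {0, \<dots>, d - 2, 1/2}\<close> and let \<open>T\<close> be the set of lattice points of the grid \<open>X \<times> X\<close> with
  \<open>i + j \<le> d - 3\<close>. A form of degree \<open>d\<close> is determined by its values on the grid outside \<open>T\<close> and
  by its coefficients of \<open>x^d\<close> and \<open>y^d\<close>. The form
  \<open>h = (z - x - y) (2z - x - y) \<cdots> ((d - 3)z - x - y)\<close> vanishes on \<open>T\<close> except at the origin, and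
  also at \<open>(1/2, 1/2)\<close>. The Cayley-Bacharach relation of the grid, weighted by \<open>h\<close>, is therefore
  a relation \<open>\<Sum> c(P) f(P) = 0\<close> with nonzero coefficients between the values of the forms \<open>f\<close> of
  degree \<open>d\<close> at the origin and at the set \<open>Z\<close> of grid points outside \<open>T\<close> other than \<open>(1/2, 1/2)\<close>.

  The functional \<open>\<ell>(g) = (\<Sum>P\<in>Z. c(P)^2 g(P)) - c(0)^2 g(0) / |Z|\<close> is positive semidefinite by the
  Cauchy-Schwarz inequality, and \<open>f\<close> is in the kernel of its bilinear form iff \<open>c(P) f(P)\<close> is
  constant on \<open>Z\<close>; this kernel has dimension 4. It contains the two products of grid lines, so
  a functional that annihilates its multiples is a combination of evaluations at the grid points.
  Another kernel form vanishes on \<open>Z\<close> and the origin but at no other point of the grid, which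
  restricts the combination to \<open>Z\<close> and the origin. The form with \<open>c(P) f(P) = 1\<close> on \<open>Z\<close> then
  fixes the coefficients up to a common factor.
\<close>

subsection \<open>Ternary forms\<close>

abbreviation cf :: "'k::zero poly3 \<Rightarrow> nat \<times> nat \<times> nat \<Rightarrow> 'k" where
  "cf \<equiv> Poly_Mapping.lookup"

abbreviation mon :: "nat \<times> nat \<times> nat \<Rightarrow> 'k::zero_neq_one poly3" where
  "mon k \<equiv> Poly_Mapping.single k 1"

definition tdeg :: "nat \<times> nat \<times> nat \<Rightarrow> nat" where
  "tdeg k = fst k + fst (snd k) + snd (snd k)"

lemma tdeg_Pair [simp]: "tdeg (a, b, c) = a + b + c"
  by (simp add: tdeg_def)

lemma tdeg_add: "tdeg (j + k) = tdeg j + tdeg k"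
  by (cases j; cases k) simp

lemma forms_iff: "p \<in> forms m \<longleftrightarrow> (\<forall>k. cf p k \<noteq> 0 \<longrightarrow> tdeg k = m)"
  by (fastforce simp: forms_def in_keys_iff)

lemma forms_keys: "p \<in> forms m \<longleftrightarrow> (\<forall>k\<in>Poly_Mapping.keys p. tdeg k = m)"
  by (auto simp: forms_iff in_keys_iff simp del: split_paired_All)

lemma cf_smul [simp]: "cf (smul c p) k = c * cf p k"
  unfolding smul_def mult_map_scale_conv_mult[symmetric]
  by (auto simp: Poly_Mapping.map.rep_eq when_def)

lemma smul_mult_left: "smul c p * q = smul c (p * q)"
  by (simp add: smul_def mult.assoc)

lemma smul_mult_right: "p * smul c q = smul c (p * q)"
  by (simp add: smul_def mult_ac)

interpretation poly3: vector_space "smul :: 'k::field \<Rightarrow> 'k poly3 \<Rightarrow> 'k poly3"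
  by standard (auto intro!: poly_mapping_eqI simp: lookup_add algebra_simps)

lemma forms_0 [simp]: "0 \<in> forms m"
  by (simp add: forms_iff)

lemma forms_add: "p \<in> forms m \<Longrightarrow> q \<in> forms m \<Longrightarrow> p + q \<in> forms m"
  unfolding forms_iff by (metis lookup_add add_0)

lemma forms_smul: "p \<in> forms m \<Longrightarrow> smul c p \<in> forms m"
  unfolding forms_iff by (metis cf_smul mult_zero_right)

lemma forms_diff: "p \<in> forms m \<Longrightarrow> q \<in> forms m \<Longrightarrow> p - q \<in> forms m"
  for p q :: "'k::ab_group_add poly3"
  unfolding forms_iff lookup_minus by (metis diff_zero)

lemma forms_sum: "(\<And>i. i \<in> I \<Longrightarrow> f i \<in> forms m) \<Longrightarrow> sum f I \<in> forms m"
  by (induction I rule: infinite_finite_induct) (auto intro: forms_add)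

lemma forms_mult: "p \<in> forms m \<Longrightarrow> q \<in> forms n \<Longrightarrow> p * q \<in> forms (m + n)"
  unfolding forms_keys using keys_mult[of p q] by (fastforce simp: tdeg_add)

lemma forms_single: "tdeg k = m \<Longrightarrow> Poly_Mapping.single k c \<in> forms m"
  by (auto simp: forms_iff lookup_single when_def)

lemma forms_one: "(1 :: 'k::comm_ring_1 poly3) \<in> forms 0"
  by (auto simp: forms_iff lookup_one when_def zero_prod_def)

lemma forms_prod:
  fixes f :: "'i \<Rightarrow> 'k::comm_ring_1 poly3"
  shows "finite I \<Longrightarrow> (\<And>i. i \<in> I \<Longrightarrow> f i \<in> forms 1) \<Longrightarrow> prod f I \<in> forms (card I)"
  by (induction I rule: finite_induct) (auto intro: forms_one forms_mult[of _ 1, simplified])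

lemma subspace_forms: "poly3.subspace (forms m)"
  by (auto simp: poly3.subspace_def intro: forms_add forms_smul)

section \<open>Monomials as a basis of the forms of fixed degree\<close>

definition exps :: "nat \<Rightarrow> (nat \<times> nat \<times> nat) set" where
  "exps m = {k. tdeg k = m}"

lemma exps_eq: "exps m = (\<lambda>(a, b). (a, b, m - a - b)) ` {(a, b). a + b \<le> m}"
  by (auto simp: exps_def image_iff)

lemma card_triangle: "card {(a, b). a + b \<le> m} = (m + 2) choose 2" and
  finite_triangle: "finite {(a, b). a + b \<le> (m::nat)}"
proof -
  have eq: "{(a, b). a + b \<le> m} = Sigma {..m} (\<lambda>a. {..m - a})"
    by auto
  show "finite {(a, b). a + b \<le> m}"
    unfolding eq by simp
  have "card {(a, b). a + b \<le> m} = (\<Sum>a\<le>m. Suc (m - a))"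
    unfolding eq by simp
  also have "\<dots> = (\<Sum>a\<le>m. Suc a)"
    using sum.nat_diff_reindex[of "\<lambda>a. Suc a" "Suc m"] by (simp add: lessThan_Suc_atMost)
  also have "\<dots> = (m + 2) choose 2"
    by (induction m) (simp_all add: numeral_2_eq_2)
  finally show "card {(a, b). a + b \<le> m} = (m + 2) choose 2" .
qed

lemma card_exps: "card (exps m) = (m + 2) choose 2" and finite_exps [simp]: "finite (exps m)"
proof -
  have "inj_on (\<lambda>(a, b). (a, b, m - a - b)) {(a, b). a + b \<le> m}"
    by (auto simp: inj_on_def)
  then show "card (exps m) = (m + 2) choose 2"
    unfolding exps_eq using card_triangle by (simp add: card_image)
  show "finite (exps m)"
    unfolding exps_eq using finite_triangle by simp
qed

lemma poly3_expand:
  assumes "finite A" "Poly_Mapping.keys p \<subseteq> A"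
  shows "p = (\<Sum>k\<in>A. smul (cf p k) (mon k))"
proof (rule poly_mapping_eqI)
  fix j
  have "cf (\<Sum>k\<in>A. smul (cf p k) (mon k)) j = (\<Sum>k\<in>A. if k = j then cf p k else 0)"
    unfolding lookup_sum by (intro sum.cong) (auto simp: lookup_single when_def)
  also have "\<dots> = cf p j"
    using assms by (auto simp: in_keys_iff)
  finally show "cf p j = cf (\<Sum>k\<in>A. smul (cf p k) (mon k)) j" ..
qed

lemma keys_forms: "p \<in> forms m \<Longrightarrow> Poly_Mapping.keys p \<subseteq> exps m"
  by (auto simp: forms_keys exps_def)

lemma span_mon: "poly3.span (mon ` exps m) = (forms m :: 'k::field poly3 set)"
proof
  show "poly3.span (mon ` exps m) \<subseteq> (forms m :: 'k poly3 set)"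
    by (intro poly3.span_minimal subspace_forms) (auto simp: exps_def intro: forms_single)
  show "(forms m :: 'k poly3 set) \<subseteq> poly3.span (mon ` exps m)"
  proof
    fix p :: "'k poly3" assume "p \<in> forms m"
    then have "p = (\<Sum>k\<in>exps m. smul (cf p k) (mon k))"
      by (intro poly3_expand) (simp_all add: keys_forms)
    moreover have "(\<Sum>k\<in>exps m. smul (cf p k) (mon k)) \<in> poly3.span (mon ` exps m)"
      by (intro poly3.span_sum poly3.span_scale poly3.span_base) auto
    ultimately show "p \<in> poly3.span (mon ` exps m)"
      by simp
  qed
qed

lemma inj_mon: "inj (mon :: _ \<Rightarrow> 'k::zero_neq_one poly3)"
  by (auto simp: inj_def poly_mapping_eq_iff fun_eq_iff lookup_single when_def split: if_splits)

lemma independent_mon: "poly3.independent (mon ` exps m :: 'k::field poly3 set)"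
proof (rule poly3.independent_if_scalars_zero)
  fix c :: "'k poly3 \<Rightarrow> 'k" and x :: "'k poly3"
  assume s: "(\<Sum>x\<in>mon ` exps m. smul (c x) x) = 0" and "x \<in> mon ` exps m"
  then obtain j where j: "j \<in> exps m" "x = mon j" by auto
  have "0 = cf (\<Sum>x\<in>mon ` exps m. smul (c x) x) j"
    using s by simp
  also have "\<dots> = (\<Sum>k\<in>exps m. if k = j then c (mon k) else 0)"
    unfolding sum.reindex[OF inj_on_subset[OF inj_mon subset_UNIV]] lookup_sum
    by (intro sum.cong) (auto simp: lookup_single when_def)
  also have "\<dots> = c x"
    using j by simp
  finally show "c x = 0" by simp
qed auto

lemma card_mon: "card (mon ` exps m :: 'k::zero_neq_one poly3 set) = (m + 2) choose 2"
  using card_exps inj_mon by (metis card_image inj_on_subset subset_UNIV)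

lemma independent_forms_card:
  fixes B :: "'k::field poly3 set"
  assumes "poly3.independent B" "B \<subseteq> forms m"
  shows "finite B \<and> card B \<le> (m + 2) choose 2"
  using poly3.independent_span_bound[of "mon ` exps m" B] assms by (simp add: span_mon card_mon)

lemma basis_forms_card:
  fixes B :: "'k::field poly3 set"
  assumes "poly3.independent B" "poly3.span B = forms m"
  shows "card B = (m + 2) choose 2"
  using assms by (metis card_mon independent_mon poly3.dim_span_eq_card_independent span_mon)

section \<open>Linear functionals given on monomials, and evaluation at points\<close>

text \<open>Linear on all polynomials, whatever their degree. Multiplicative \<open>\<phi>\<close>
  give evaluations at points; \<open>\<phi>\<close> supported in one degree give functionals on the
  forms of that degree.\<close>

definition Lin :: "(nat \<times> nat \<times> nat \<Rightarrow> 'k) \<Rightarrow> 'k::comm_ring_1 poly3 \<Rightarrow> 'k" where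
  "Lin \<phi> p = (\<Sum>k\<in>Poly_Mapping.keys p. cf p k * \<phi> k)"

lemma Lin_superset:
  assumes "finite A" "Poly_Mapping.keys p \<subseteq> A"
  shows "Lin \<phi> p = (\<Sum>k\<in>A. cf p k * \<phi> k)"
  unfolding Lin_def using assms by (intro sum.mono_neutral_left) (auto simp: in_keys_iff)

lemma Lin_add: "Lin \<phi> (p + q) = Lin \<phi> p + Lin \<phi> q"
proof -
  let ?A = "Poly_Mapping.keys p \<union> Poly_Mapping.keys q"
  have "Poly_Mapping.keys (p + q) \<subseteq> ?A"
    by (rule Poly_Mapping.keys_add)
  then show ?thesis
    using Lin_superset[of ?A p \<phi>] Lin_superset[of ?A q \<phi>] Lin_superset[of ?A "p + q" \<phi>]
    by (simp add: lookup_add algebra_simps sum.distrib)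
qed

lemma Lin_smul: "Lin \<phi> (smul c p) = c * Lin \<phi> p"
proof -
  have "Poly_Mapping.keys (smul c p) \<subseteq> Poly_Mapping.keys p"
    by (auto simp: in_keys_iff)
  then show ?thesis
    using Lin_superset[of "Poly_Mapping.keys p" "smul c p" \<phi>]
    by (simp add: Lin_def sum_distrib_left mult.assoc)
qed

lemma Lin_0 [simp]: "Lin \<phi> 0 = 0"
  by (simp add: Lin_def)

lemma Lin_diff: "Lin \<phi> (p - q) = Lin \<phi> p - Lin \<phi> q"
  using Lin_add[of \<phi> "p - q" q] by simp

lemma Lin_sum: "Lin \<phi> (sum f I) = (\<Sum>i\<in>I. Lin \<phi> (f i))"
  by (induction I rule: infinite_finite_induct) (auto simp: Lin_add)

lemma Lin_single [simp]: "Lin \<phi> (Poly_Mapping.single k c) = c * \<phi> k"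
  by (simp add: Lin_def)

text \<open>Both sides are bilinear, so the claim reduces to products of monomials, where it is the
  assumption on \<open>\<phi>\<close>.\<close>

lemma Lin_mult:
  assumes "\<And>j k. \<phi> (j + k) = \<phi> j * \<phi> k"
  shows "Lin \<phi> (p * q) = Lin \<phi> p * Lin \<phi> q"
proof -
  have *: "Lin \<phi> (mon j * q) = \<phi> j * Lin \<phi> q" for j
  proof -
    have "mon j * q = (\<Sum>k\<in>Poly_Mapping.keys q. smul (cf q k) (mon (j + k)))"
      by (subst poly3_expand[of "Poly_Mapping.keys q" q])
        (simp_all add: sum_distrib_left smul_mult_right mult_single)
    then show ?thesis
      by (simp add: Lin_sum Lin_smul assms Lin_def[of _ q] sum_distrib_left mult_ac)
  qed
  have "p * q = (\<Sum>k\<in>Poly_Mapping.keys p. smul (cf p k) (mon k * q))"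
    by (subst poly3_expand[of "Poly_Mapping.keys p" p])
      (simp_all add: sum_distrib_right smul_mult_left)
  then show ?thesis
    by (simp add: Lin_sum Lin_smul * Lin_def[of _ p] sum_distrib_right mult.assoc)
qed

definition ev :: "real \<times> real \<times> real \<Rightarrow> real poly3 \<Rightarrow> real" where
  "ev = (\<lambda>(x, y, z). Lin (\<lambda>(a, b, c). x ^ a * y ^ b * z ^ c))"

lemma ev_add: "ev P (p + q) = ev P p + ev P q"
  and ev_diff: "ev P (p - q) = ev P p - ev P q"
  and ev_smul: "ev P (smul c p) = c * ev P p"
  and ev_sum: "ev P (sum f I) = (\<Sum>i\<in>I. ev P (f i))"
  and ev_0: "ev P 0 = 0"
  by (cases P; simp add: ev_def Lin_add Lin_diff Lin_smul Lin_sum)+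

lemma ev_mult: "ev P (p * q) = ev P p * ev P q"
  by (cases P) (auto simp: ev_def power_add intro!: Lin_mult)

lemma ev_single: "ev (x, y, z) (Poly_Mapping.single (a, b, c) r) = r * (x ^ a * y ^ b * z ^ c)"
  by (simp add: ev_def)

lemma ev_one: "ev P 1 = 1"
  by (cases P) (simp add: ev_single flip: single_one add: zero_prod_def)

lemma ev_prod: "ev P (prod f I) = (\<Prod>i\<in>I. ev P (f i))"
  by (induction I rule: infinite_finite_induct) (auto simp: ev_mult ev_one)

text \<open>An injective linear map between spaces of equal finite dimension is surjective;
  \<open>e i\<close> is a preimage of the \<open>i\<close>-th unit vector. Value vectors are
  extended by 0 outside \<open>I\<close>, so that the target is a full function type.\<close>

lemma dual_basis_forms:
  fixes F :: "'i \<Rightarrow> real poly3 \<Rightarrow> real"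
  assumes "finite I" and card: "card I = (m + 2) choose 2"
    and lin: "\<And>i p q. F i (p + q) = F i p + F i q" "\<And>i c p. F i (smul c p) = c * F i p"
    and inj: "\<And>p. p \<in> forms m \<Longrightarrow> (\<And>i. i \<in> I \<Longrightarrow> F i p = 0) \<Longrightarrow> p = 0"
  shows "\<exists>e. \<forall>i\<in>I. e i \<in> forms m \<and> (\<forall>j\<in>I. F j (e i) = (if i = j then 1 else 0))"
proof -
  define L where "L p = (\<lambda>i. if i \<in> I then F i p else 0)" for p
  define \<delta> :: "'i \<Rightarrow> 'i \<Rightarrow> real" where "\<delta> i j = (if i = j then 1 else 0)" for i j
  interpret P: vector_space_pair "smul :: real \<Rightarrow> real poly3 \<Rightarrow> real poly3"
      "scaleR :: real \<Rightarrow> ('i \<Rightarrow> real) \<Rightarrow> 'i \<Rightarrow> real"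
    ..
  have linL: "Vector_Spaces.linear smul scaleR L"
    by unfold_locales (auto simp: L_def lin scaleR_fun_def fun_eq_iff)
  let ?B = "mon ` exps m :: real poly3 set"
  have "inj_on L (poly3.span ?B)"
    unfolding P.linear_inj_on_iff_eq_0[OF linL poly3.subspace_span] unfolding span_mon
    by (auto simp: L_def fun_eq_iff intro!: inj split: if_splits)
  then have ind: "independent (L ` ?B)" and cB: "card (L ` ?B) = card I"
    using P.linear_independent_injective_image[OF linL independent_mon]
      card_image[OF inj_on_subset[OF _ poly3.span_superset], of L ?B]
    by (simp_all only: dependent_raw_def card_mon card not_False_eq_True)
  have T: "f \<in> span (\<delta> ` I)" if "\<And>i. i \<notin> I \<Longrightarrow> f i = 0" for f :: "'i \<Rightarrow> real"
  proof -
    have "(\<Sum>i\<in>I. f i *\<^sub>R \<delta> i) j = (\<Sum>i\<in>I. if i = j then f i else 0)" for j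
      using \<open>finite I\<close> by (induction rule: finite_induct) (auto simp: scaleR_fun_def \<delta>_def)
    then have "f = (\<Sum>i\<in>I. f i *\<^sub>R \<delta> i)"
      using that \<open>finite I\<close> by auto
    then show ?thesis
      by (metis (no_types, lifting) imageI span_base span_scale span_sum)
  qed
  have "\<exists>p\<in>forms m. L p = \<delta> i" if "i \<in> I" for i
  proof -
    \<comment> \<open>Otherwise adjoining \<open>\<delta> i\<close> to the images of the monomials
      would give \<open>card I + 1\<close> independent vectors in the span of \<open>card I\<close>
      vectors.\<close>
    have "\<delta> i \<in> span (L ` ?B)"
    proof (rule ccontr)
      assume n: "\<delta> i \<notin> span (L ` ?B)"
      have "insert (\<delta> i) (L ` ?B) \<subseteq> span (\<delta> ` I)"
        using that span_base[of "\<delta> i" "\<delta> ` I"] by (auto intro!: T simp: L_def)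
      moreover have "independent (insert (\<delta> i) (L ` ?B))"
        using n ind by (rule independent_insertI)
      ultimately have "card (insert (\<delta> i) (L ` ?B)) \<le> card (\<delta> ` I)"
        using independent_span_bound \<open>finite I\<close> by blast
      also have "\<dots> \<le> card I"
        using \<open>finite I\<close> by (rule card_image_le)
      finally have "card (insert (\<delta> i) (L ` ?B)) \<le> card I" .
      moreover have "\<delta> i \<notin> L ` ?B"
        using n span_base[of "\<delta> i" "L ` ?B"] by blast
      ultimately show False
        using cB by simp
    qed
    moreover have "span (L ` ?B) = L ` forms m"
      using P.linear_span_image[OF linL, of ?B] by (simp only: span_raw_def span_mon)
    ultimately show ?thesis
      by (metis imageE)
  qed
  then obtain e where e: "\<And>i. i \<in> I \<Longrightarrow> e i \<in> forms m \<and> L (e i) = \<delta> i"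
    by metis
  have "F j (e i) = (if i = j then 1 else 0)" if "i \<in> I" "j \<in> I" for i j
    using that fun_cong[OF conjunct2[OF e[OF that(1)]], of j] by (simp add: L_def \<delta>_def)
  with e show ?thesis
    by blast
qed

section \<open>Linear forms, interpolation weights and products of linear forms\<close>

definition lf :: "real \<Rightarrow> real \<Rightarrow> real \<Rightarrow> real poly3" where
  "lf a b c = Poly_Mapping.single (1, 0, 0) a + Poly_Mapping.single (0, 1, 0) b
    + Poly_Mapping.single (0, 0, 1) c"

lemma lf_forms [simp]: "lf a b c \<in> forms 1" "lf a b c \<in> forms (Suc 0)"
  unfolding lf_def by (auto intro!: forms_add forms_single)

lemma ev_lf [simp]: "ev (x, y, z) (lf a b c) = a * x + b * y + c * z"
  by (simp add: lf_def ev_add ev_single)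

lemma ev_expand:
  assumes "f \<in> forms m"
  shows "ev P f = (\<Sum>k\<in>exps m. cf f k * ev P (mon k))"
  by (cases P) (simp add: ev_def Lin_superset[OF finite_exps keys_forms[OF assms]])

text \<open>These are the weights of the divided difference on \<open>X\<close>: they give the
  coefficient of degree \<open>card X - 1\<close> in the Lagrange interpolant, and this coefficient
  is 0 for powers of smaller degree.\<close>

lemma divided_difference_weights:
  fixes X :: "real set"
  assumes "finite X"
  shows "\<exists>\<omega>. (\<forall>x\<in>X. \<omega> x \<noteq> 0) \<and> (\<forall>k. Suc k < card X \<longrightarrow> (\<Sum>x\<in>X. \<omega> x * x ^ k) = 0)"
proof (intro exI conjI ballI allI impI)
  define \<omega> where "\<omega> x = inverse (\<Prod>y\<in>X - {x}. x - y)" for x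
  show "\<omega> x \<noteq> 0" if "x \<in> X" for x
    using assms by (auto simp: \<omega>_def)
  fix k assume k: "Suc k < card X"
  define m where "m = card X - 1"
  define B where "B x = (\<Prod>y\<in>X - {x}. [:- y, 1:])" for x :: real
  \<comment> \<open>The Lagrange interpolant of \<open>x ^ k\<close> minus \<open>x ^ k\<close>
    itself; it has degree at most \<open>m\<close> and \<open>m + 1\<close> roots.\<close>
  define q where "q = (\<Sum>x\<in>X. smult (x ^ k * \<omega> x) (B x)) - monom 1 k"
  have degB: "degree (B x) = m" if "x \<in> X" for x
    using assms that unfolding B_def m_def by (subst degree_prod_eq_sum_degree) auto
  have lcB: "coeff (B x) m = 1" if "x \<in> X" for x
    using degB[OF that] lead_coeff_prod[of "\<lambda>y. [:- y, 1:]" "X - {x}"] by (simp add: B_def)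
  have "degree q \<le> m"
    unfolding q_def using k degB
    by (intro degree_diff_le degree_sum_le) (auto simp: assms m_def degree_monom_eq)
  moreover have "poly q y = 0" if "y \<in> X" for y
  proof -
    have "poly (B x) y = (if x = y then inverse (\<omega> y) else 0)" if "x \<in> X" for x
      using \<open>y \<in> X\<close> assms that by (auto simp: B_def \<omega>_def poly_prod)
    then have "poly q y = (\<Sum>x\<in>X. if x = y then x ^ k * \<omega> x * inverse (\<omega> y) else 0) - y ^ k"
      unfolding q_def by (auto simp: poly_sum poly_monom intro!: sum.cong)
    also have "\<dots> = 0"
      using that assms by (auto simp: \<omega>_def)
    finally show ?thesis .
  qed
  moreover from this have "X \<subseteq> {x. poly q x = 0}"
    by blast
  ultimately have "q = 0"
  proof (rule_tac ccontr)
    assume "degree q \<le> m" "X \<subseteq> {x. poly q x = 0}" "q \<noteq> 0"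
    then have "card X \<le> degree q"
      using card_mono[OF poly_roots_finite, of q X] card_poly_roots_bound[of q] by linarith
    then show False
      using \<open>degree q \<le> m\<close> k by (simp add: m_def)
  qed
  then have "0 = coeff q m"
    by simp
  also have "\<dots> = (\<Sum>x\<in>X. x ^ k * \<omega> x)"
    using k lcB by (auto simp: q_def coeff_sum m_def intro!: sum.cong)
  finally show "(\<Sum>x\<in>X. \<omega> x * x ^ k) = 0"
    by (simp add: mult.commute)
qed

text \<open>Multiplying out, every term but the leading one picks up at least one factor
  \<open>z\<close>. The map \<open>k\<close> embeds an exponent as one of \<open>x\<close> or of
  \<open>y\<close>, so that one induction serves both variables.\<close>

lemma prod_keys:
  fixes l :: "'a \<Rightarrow> real poly3"
  assumes "finite S" and l: "\<And>x. l x = mon (k 1) + Poly_Mapping.single (0, 0, 1) (r x)"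
    and k: "k 0 = 0" "\<And>m n. k (m + n) = k m + k n"
  shows "cf (prod l S - mon (k (card S))) j \<noteq> 0 \<Longrightarrow> \<exists>a<card S. \<exists>c. j = k a + (0, 0, c)"
  using assms(1)
proof (induction S arbitrary: j rule: finite_induct)
  case empty
  then show ?case by (simp add: k)
next
  case (insert x S)
  let ?R = "prod l S - mon (k (card S))" and ?z = "Poly_Mapping.single (0, 0, 1) (r x)"
  \<comment> \<open>The new remainder is the old one times the new factor, plus \<open>z\<close>
    times the old leading term.\<close>
  have "prod l (insert x S) - mon (k (card (insert x S)))
      = mon (k 1) * ?R + (?z * mon (k (card S)) + ?z * ?R)"
    using insert.hyps k(2)[of 1 "card S"] by (simp add: l algebra_simps mult_single)
  then have "j \<in> Poly_Mapping.keys (mon (k 1) * ?R + (?z * mon (k (card S)) + ?z * ?R))"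
    using insert.prems by (simp add: in_keys_iff)
  then consider "j \<in> Poly_Mapping.keys (mon (k 1) * ?R)" | "j \<in> Poly_Mapping.keys (?z * mon (k (card S)))"
    | "j \<in> Poly_Mapping.keys (?z * ?R)"
    by (meson Poly_Mapping.keys_add UnE subsetD)
  then show ?case
  proof cases
    case 1
    then obtain i j' where "i \<in> Poly_Mapping.keys (mon (k 1) :: real poly3)" "j = i + j'"
      and *: "cf ?R j' \<noteq> 0"
      using keys_mult[of "mon (k 1)" ?R] unfolding in_keys_iff[symmetric] by blast
    then have j: "j = k 1 + j'"
      by (simp del: One_nat_def split: if_splits)
    from insert.IH[OF *] obtain a c where a: "a < card S" "j' = k a + (0, 0, c)"
      by blast
    then have "j = k (1 + a) + (0, 0, c)"
      by (simp only: j k(2) add.assoc)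
    then show ?thesis using insert.hyps a by (intro exI[of _ "1 + a"]) auto
  next
    case 2
    then have "j = k (card S) + (0, 0, 1)"
      by (auto simp: mult_single add.commute split: if_splits)
    then show ?thesis using insert.hyps by (intro exI[of _ "card S"]) auto
  next
    case 3
    then obtain i j' where j: "i \<in> Poly_Mapping.keys ?z" "j = i + j'" "cf ?R j' \<noteq> 0"
      using keys_mult[of ?z ?R] unfolding in_keys_iff[symmetric] by blast
    with insert.IH[of j'] obtain a c where a: "a < card S" "j' = k a + (0, 0, c)"
      by blast
    have "i = (0, 0, 1)"
      using j(1) by (simp split: if_splits)
    then have "j = k a + (0, 0, Suc c)"
      using j(2) a(2) by (cases "k a") simp
    then show ?thesis using insert.hyps a by (intro exI[of _ a]) auto
  qed
qed

subsection \<open>Ranks and Hilbert functions\<close>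

context vector_space
begin

text \<open>Coefficients over \<open>S \<union> C\<close> are unique; those of \<open>x\<close> are
  supported in \<open>S\<close> and also in \<open>C\<close>, hence vanish.\<close>

lemma span_Int_independent:
  assumes ind: "independent (S \<union> C)" and dis: "S \<inter> C = {}" and x: "x \<in> span S" "x \<in> span C"
  shows "x = 0"
proof -
  have S: "representation (S \<union> C) x = representation S x"
    using ind x(1) by (rule representation_extend) simp
  have C: "representation (S \<union> C) x = representation C x"
    using ind x(2) by (rule representation_extend) simp
  have "representation (S \<union> C) x b = 0" for b
    using representation_ne_zero[of S x b] representation_ne_zero[of C x b] S C dis by fastforce
  moreover have "x \<in> span (S \<union> C)"
    using x(1) span_mono[of S "S \<union> C"] by blast
  ultimately show "x = 0"
    using sum_nonzero_representation_eq[OF ind] by fastforce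
qed

end

text \<open>Extend the basis \<open>S\<close> of the kernel by \<open>C\<close> to a basis of all
  forms. Then \<open>B\<close> is injective on the span of \<open>C\<close>, and the image of
  \<open>C\<close> is a basis of the image.\<close>

lemma rank_nullity_forms:
  fixes B :: "real poly3 \<Rightarrow> 'v::real_vector"
  assumes lin: "Vector_Spaces.linear smul scaleR B" and S: "poly3.independent S" "poly3.span S = {f \<in> forms m. B f = 0}"
  shows "dim (B ` forms m) = ((m + 2) choose 2) - card S"
proof -
  interpret P: vector_space_pair "smul :: real \<Rightarrow> real poly3 \<Rightarrow> real poly3"
      "scaleR :: real \<Rightarrow> 'v \<Rightarrow> 'v"
    ..
  have Sf: "S \<subseteq> forms m" using S poly3.span_superset by blast
  obtain A where A: "S \<subseteq> A" "A \<subseteq> forms m" "poly3.independent A" "forms m \<subseteq> poly3.span A"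
    using poly3.maximal_independent_subset_extend[OF Sf S(1)] by blast
  define C where "C = A - S"
  have AC: "A = S \<union> C" "S \<inter> C = {}" using A by (auto simp: C_def)
  have spA: "poly3.span A = forms m"
    using A subspace_forms poly3.span_minimal by blast
  have fin: "finite A" and cA: "card A = (m + 2) choose 2"
    using independent_forms_card[OF A(3,2)] basis_forms_card[OF A(3) spA] by auto
  have CA: "C \<subseteq> forms m" "poly3.independent C"
    using A poly3.independent_mono[OF A(3), of C] by (auto simp: C_def)
  have Cf: "poly3.span C \<subseteq> forms m"
    using CA poly3.span_minimal subspace_forms by blast
  have inj: "inj_on B (poly3.span C)"
    unfolding P.linear_inj_on_iff_eq_0[OF lin poly3.subspace_span]
    using S(2) Cf poly3.span_Int_independent[of S C] A(3) AC by blast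
  have ind: "independent (B ` C)"
    using P.linear_independent_injective_image[OF lin CA(2) inj] by (simp only: dependent_raw_def not_False_eq_True)
  have sp: "span (B ` C) = B ` poly3.span C"
    using P.linear_span_image[OF lin, of C] by (simp only: span_raw_def)
  have "B ` forms m \<subseteq> span (B ` C)"
  proof
    fix y assume "y \<in> B ` forms m"
    then obtain f where f: "f \<in> poly3.span (S \<union> C)" "y = B f" using spA AC by auto
    then obtain a b where ab: "f = a + b" "a \<in> poly3.span S" "b \<in> poly3.span C"
      unfolding poly3.span_Un by auto
    have "B f = B a + B b" using P.linear_add[OF lin] ab by simp
    also have "B a = 0" using ab S by blast
    finally show "y \<in> span (B ` C)" using ab f sp by auto
  qed
  then have "dim (B ` forms m) = card (B ` C)"
    using ind CA by (intro dim_unique[of "B ` C"]) auto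
  also have "\<dots> = card C"
    using inj poly3.span_superset by (intro card_image) (rule inj_on_subset)
  also have "\<dots> = card A - card S"
    using A(1) finite_subset[OF A(1) fin] by (simp add: C_def card_Diff_subset)
  finally show ?thesis by (simp add: cA)
qed

text \<open>A quotient basis and a basis of the degree \<open>i\<close> part of \<open>I\<close>
  together form a basis of \<open>forms i\<close>. This is the uniqueness that the definite
  description in \<open>Hilb\<close> asks for.\<close>

lemma quotient_basis_card:
  assumes I: "poly3.subspace I" and S: "poly3.independent S" "poly3.span S = I \<inter> forms i"
    and B: "quotient_basis I i B"
  shows "card B = ((i + 2) choose 2) - card S"
proof -
  have Bp: "B \<subseteq> forms i" "finite B"
    "\<And>c. (\<Sum>b\<in>B. smul (c b) b) \<in> I \<Longrightarrow> \<forall>b\<in>B. c b = 0"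
    "\<And>p. p \<in> forms i \<Longrightarrow> \<exists>c. p - (\<Sum>b\<in>B. smul (c b) b) \<in> I"
    using B by (auto simp: quotient_basis_def)
  have SI: "S \<subseteq> I" "S \<subseteq> forms i"
    using S(2) poly3.span_superset by blast+
  have finS: "finite S"
    using independent_forms_card[OF S(1) SI(2)] by blast
  have dis: "B \<inter> S = {}"
  proof (rule ccontr)
    assume "B \<inter> S \<noteq> {}"
    then obtain x where x: "x \<in> B" "x \<in> S" by blast
    \<comment> \<open>A common element lies in \<open>I\<close>, so the coefficient vector
      concentrated at it contradicts independence modulo \<open>I\<close>.\<close>
    have "(\<Sum>b\<in>B. smul (if b = x then 1 else 0) b) = (\<Sum>b\<in>B. if b = x then b else 0)"
      by (intro sum.cong) auto
    also have "\<dots> = x" using Bp(2) x by simp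
    finally have "(\<Sum>b\<in>B. smul (if b = x then 1 else 0) b) \<in> I" using x SI by auto
    from Bp(3)[OF this] x(1) show False by auto
  qed
  have ind: "poly3.independent (B \<union> S)"
  proof (rule poly3.independent_if_scalars_zero)
    fix c x assume s: "(\<Sum>x\<in>B \<union> S. smul (c x) x) = 0" and x: "x \<in> B \<union> S"
    have s': "(\<Sum>x\<in>B. smul (c x) x) + (\<Sum>x\<in>S. smul (c x) x) = 0"
      using s dis Bp(2) finS by (simp add: sum.union_disjoint)
    then have "(\<Sum>x\<in>B. smul (c x) x) = - (\<Sum>x\<in>S. smul (c x) x)"
      by (simp add: eq_neg_iff_add_eq_0)
    also have "\<dots> \<in> I"
      using SI I by (intro poly3.subspace_neg poly3.subspace_sum poly3.subspace_scale) auto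
    finally have z: "\<forall>b\<in>B. c b = 0" by (rule Bp(3))
    then have "(\<Sum>x\<in>S. smul (c x) x) = 0" using s' by simp
    then have "\<forall>x\<in>S. c x = 0"
      using poly3.independentD[OF S(1) finS order_refl] by blast
    then show "c x = 0" using z x by blast
  qed (use Bp finS in auto)
  have "poly3.span (B \<union> S) = forms i"
  proof
    show "poly3.span (B \<union> S) \<subseteq> forms i"
      using Bp SI by (intro poly3.span_minimal subspace_forms) auto
    show "forms i \<subseteq> poly3.span (B \<union> S)"
    proof
      fix p :: "complex poly3" assume p: "p \<in> forms i"
      from Bp(4)[OF this] obtain c where c: "p - (\<Sum>b\<in>B. smul (c b) b) \<in> I" by blast
      have "(\<Sum>b\<in>B. smul (c b) b) \<in> forms i"
        using Bp by (intro forms_sum forms_smul) auto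
      with c p have "p - (\<Sum>b\<in>B. smul (c b) b) \<in> poly3.span S"
        unfolding S(2) by (simp add: forms_diff)
      then have "p - (\<Sum>b\<in>B. smul (c b) b) \<in> poly3.span (B \<union> S)"
        using poly3.span_mono[of S "B \<union> S"] by blast
      moreover have "(\<Sum>b\<in>B. smul (c b) b) \<in> poly3.span (B \<union> S)"
        by (intro poly3.span_sum poly3.span_scale poly3.span_base) auto
      ultimately show "p \<in> poly3.span (B \<union> S)"
        using poly3.span_add by fastforce
    qed
  qed
  then have "card (B \<union> S) = (i + 2) choose 2"
    by (rule basis_forms_card[OF ind])
  then show ?thesis using dis Bp(2) finS by (simp add: card_Un_disjoint)
qed

text \<open>Extend \<open>S\<close> to a basis of \<open>forms i\<close>; the added elements are a
  quotient basis.\<close>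

lemma quotient_basis_exists:
  assumes I: "poly3.subspace I" and S: "poly3.independent S" "poly3.span S = I \<inter> forms i"
  shows "\<exists>B. quotient_basis I i B"
proof -
  have SI: "S \<subseteq> I" "S \<subseteq> forms i"
    using S(2) poly3.span_superset by blast+
  obtain A where A: "S \<subseteq> A" "A \<subseteq> forms i" "poly3.independent A" "forms i \<subseteq> poly3.span A"
    using poly3.maximal_independent_subset_extend[OF SI(2) S(1)] by blast
  have fin: "finite A"
    using independent_forms_card[OF A(3,2)] by blast
  define B where "B = A - S"
  have AB: "A = S \<union> B" "S \<inter> B = {}" and fB: "finite B" using A fin by (auto simp: B_def)
  have Bf: "B \<subseteq> forms i" and Bind: "poly3.independent B"
    using A poly3.independent_mono[OF A(3), of B] by (auto simp: B_def)
  have "quotient_basis I i B"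
    unfolding quotient_basis_def
  proof (intro conjI Bf fB allI impI)
    fix c assume m: "(\<Sum>b\<in>B. smul (c b) b) \<in> I"
    have "(\<Sum>b\<in>B. smul (c b) b) \<in> forms i"
      using Bf by (intro forms_sum forms_smul) auto
    then have "(\<Sum>b\<in>B. smul (c b) b) \<in> poly3.span S"
      using m S(2) by blast
    moreover have "(\<Sum>b\<in>B. smul (c b) b) \<in> poly3.span B"
      by (intro poly3.span_sum poly3.span_scale poly3.span_base)
    ultimately have "(\<Sum>b\<in>B. smul (c b) b) = 0"
      using poly3.span_Int_independent[of S B] A(3) AB by blast
    then show "\<forall>b\<in>B. c b = 0"
      using poly3.independentD[OF Bind fB order_refl] by blast
  next
    show "\<forall>p\<in>forms i. \<exists>c. p - (\<Sum>b\<in>B. smul (c b) b) \<in> I"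
    proof
      fix p :: "complex poly3" assume "p \<in> forms i"
      then have "p \<in> poly3.span (S \<union> B)" using A AB by auto
      then obtain a b where ab: "p = a + b" "a \<in> poly3.span S" "b \<in> poly3.span B"
        unfolding poly3.span_Un by auto
      from ab(3) obtain c where "b = (\<Sum>v\<in>B. smul (c v) v)"
        unfolding poly3.span_finite[OF fB] by auto
      then have "p - (\<Sum>v\<in>B. smul (c v) v) \<in> I"
        using ab S(2) by auto
      then show "\<exists>c. p - (\<Sum>b\<in>B. smul (c b) b) \<in> I" by blast
    qed
  qed
  then show ?thesis ..
qed

lemma Hilb_eq:
  assumes "poly3.subspace I" "poly3.independent S" "poly3.span S = I \<inter> forms i"
  shows "Hilb I i = ((i + 2) choose 2) - card S"
  unfolding Hilb_def
  using quotient_basis_exists[OF assms] quotient_basis_card[OF assms]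
  by (intro the_equality) auto

subsection \<open>Real and complex forms\<close>

abbreviation reP :: "complex poly3 \<Rightarrow> real poly3" where "reP \<equiv> Poly_Mapping.map Re"
abbreviation imP :: "complex poly3 \<Rightarrow> real poly3" where "imP \<equiv> Poly_Mapping.map Im"
abbreviation ofP :: "real poly3 \<Rightarrow> complex poly3" where "ofP \<equiv> Poly_Mapping.map complex_of_real"

lemma cf_map [simp]: "cf (reP p) k = Re (cf p k)" "cf (imP p) k = Im (cf p k)"
  "cf (ofP q) k = complex_of_real (cf q k)"
  by (auto simp: Poly_Mapping.map.rep_eq when_def)

lemma forms_map: "p \<in> forms m \<Longrightarrow> reP p \<in> forms m" "p \<in> forms m \<Longrightarrow> imP p \<in> forms m"
  "q \<in> forms m \<Longrightarrow> ofP q \<in> forms m"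
  unfolding forms_iff cf_map by (metis zero_complex.sel of_real_0)+

lemma complex_split: "p = ofP (reP p) + smul \<i> (ofP (imP p))"
  by (rule poly_mapping_eqI) (simp add: lookup_add complex_eq)

lemma ofP_add: "ofP (p + q) = ofP p + ofP q"
  and ofP_smul: "ofP (smul r p) = smul (complex_of_real r) (ofP p)"
  and ofP_mon: "ofP (mon k) = mon k"
  by (auto intro!: poly_mapping_eqI simp: lookup_add lookup_single when_def)

lemma ofP_0: "ofP 0 = 0"
  by (auto intro: poly_mapping_eqI)

lemma ofP_sum: "ofP (sum f I) = (\<Sum>i\<in>I. ofP (f i))"
  by (induction I rule: infinite_finite_induct) (auto simp: ofP_0 ofP_add)

lemma ofP_mult: "ofP (p * q) = ofP p * ofP q"
proof -
  let ?K = "Poly_Mapping.keys p" and ?K' = "Poly_Mapping.keys q"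
  have p: "p = (\<Sum>k\<in>?K. smul (cf p k) (mon k))" and q: "q = (\<Sum>k\<in>?K'. smul (cf q k) (mon k))"
    by (intro poly3_expand; simp)+
  have "p * q = (\<Sum>j\<in>?K. \<Sum>k\<in>?K'. smul (cf p j * cf q k) (mon (j + k)))"
    by (subst p, subst q) (simp add: sum_product smul_mult_left smul_mult_right mult_single mult.commute)
  then have "ofP (p * q) = (\<Sum>j\<in>?K. \<Sum>k\<in>?K'. smul (complex_of_real (cf p j) * complex_of_real (cf q k)) (mon (j + k)))"
    by (simp add: ofP_sum ofP_smul ofP_mon)
  also have "\<dots> = ofP (\<Sum>k\<in>?K. smul (cf p k) (mon k)) * ofP (\<Sum>k\<in>?K'. smul (cf q k) (mon k))"
    by (simp add: ofP_sum ofP_smul ofP_mon sum_product smul_mult_left smul_mult_right mult_single mult.commute)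
  finally show ?thesis using p q by simp
qed

lemma Lin_ofP: "Lin (\<lambda>k. complex_of_real (\<phi> k)) (ofP p) = complex_of_real (Lin \<phi> p)"
proof -
  have "Poly_Mapping.keys (ofP p) = Poly_Mapping.keys p"
    by (auto simp: in_keys_iff)
  then show ?thesis by (simp add: Lin_def)
qed

text \<open>The functional is real on real forms. Hence real test forms separate the real and
  imaginary parts of \<open>p\<close>, and a complex test form is a combination of two real
  ones.\<close>

lemma Lin_complex_orthogonal:
  fixes \<phi> :: "nat \<times> nat \<times> nat \<Rightarrow> real"
  shows "(\<forall>q\<in>forms k. Lin (\<lambda>j. complex_of_real (\<phi> j)) (p * q) = 0) \<longleftrightarrow>
    (\<forall>q\<in>forms k. Lin \<phi> (reP p * q) = 0) \<and> (\<forall>q\<in>forms k. Lin \<phi> (imP p * q) = 0)"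
proof -
  let ?L = "Lin (\<lambda>j. complex_of_real (\<phi> j))"
  have real: "?L (p * ofP q) = complex_of_real (Lin \<phi> (reP p * q)) + \<i> * complex_of_real (Lin \<phi> (imP p * q))" for q
    by (subst complex_split[of p])
      (simp add: distrib_right Lin_add Lin_smul smul_mult_left Lin_ofP flip: ofP_mult)
  have split: "?L (p * q) = ?L (p * ofP (reP q)) + \<i> * ?L (p * ofP (imP q))" for q
    by (subst complex_split[of q]) (simp add: distrib_left Lin_add Lin_smul smul_mult_right)
  have z: "?L (p * ofP q) = 0 \<longleftrightarrow> Lin \<phi> (reP p * q) = 0 \<and> Lin \<phi> (imP p * q) = 0" for q
    unfolding real by (simp add: complex_eq_iff)
  show ?thesis
  proof
    assume "\<forall>q\<in>forms k. ?L (p * q) = 0"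
    then show "(\<forall>q\<in>forms k. Lin \<phi> (reP p * q) = 0) \<and> (\<forall>q\<in>forms k. Lin \<phi> (imP p * q) = 0)"
      using z forms_map(3) by blast
  next
    assume "(\<forall>q\<in>forms k. Lin \<phi> (reP p * q) = 0) \<and> (\<forall>q\<in>forms k. Lin \<phi> (imP p * q) = 0)"
    then show "\<forall>q\<in>forms k. ?L (p * q) = 0"
      using z forms_map(1,2) split by (metis add_0 mult_zero_right)
  qed
qed

text \<open>The real and imaginary parts of a complex combination of real forms are the combinations
  with the real and imaginary parts of the coefficients. Complexification thus keeps independence
  and dimension.\<close>

lemma complexify_span:
  assumes ind: "poly3.independent S" and fin: "finite S"
  shows "poly3.independent (ofP ` S)" "card (ofP ` S) = card S"
    "poly3.span (ofP ` S) = {p. reP p \<in> poly3.span S \<and> imP p \<in> poly3.span S}"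
proof -
  have inj: "inj_on ofP A" for A
    by (auto simp: inj_on_def poly_mapping_eq_iff fun_eq_iff simp flip: cf_map(3))
      (metis cf_map(3) of_real_eq_iff)
  show "card (ofP ` S) = card S"
    using inj by (rule card_image)
  have parts: "reP (\<Sum>s\<in>S. smul (c s) (ofP s)) = (\<Sum>s\<in>S. smul (Re (c s)) s)"
      "imP (\<Sum>s\<in>S. smul (c s) (ofP s)) = (\<Sum>s\<in>S. smul (Im (c s)) s)" for c :: "real poly3 \<Rightarrow> complex"
    by (rule poly_mapping_eqI, simp add: lookup_sum)+
  show "poly3.independent (ofP ` S)"
  proof (rule poly3.independent_if_scalars_zero)
    fix c x assume s: "(\<Sum>x\<in>ofP ` S. smul (c x) x) = 0" and "x \<in> ofP ` S"
    then obtain s0 where s0: "s0 \<in> S" "x = ofP s0" by auto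
    have z: "(\<Sum>s\<in>S. smul (c (ofP s)) (ofP s)) = 0"
      using s by (simp add: sum.reindex[OF inj])
    have "(\<Sum>s\<in>S. smul (Re (c (ofP s))) s) = 0" "(\<Sum>s\<in>S. smul (Im (c (ofP s))) s) = 0"
      unfolding parts[symmetric] z by (auto intro: poly_mapping_eqI)
    then have "Re (c x) = 0" "Im (c x) = 0"
      using poly3.independentD[OF ind fin order_refl _ s0(1), of "\<lambda>s. Re (c (ofP s))"]
        poly3.independentD[OF ind fin order_refl _ s0(1), of "\<lambda>s. Im (c (ofP s))"] s0 by auto
    then show "c x = 0" by (simp add: complex_eq_iff)
  qed (use fin in simp)
  have fin': "finite (ofP ` S)" using fin by simp
  have of_span: "ofP f \<in> poly3.span (ofP ` S)" if "f \<in> poly3.span S" for f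
  proof -
    from that obtain c where "f = (\<Sum>s\<in>S. smul (c s) s)"
      unfolding poly3.span_finite[OF fin] by auto
    then have "ofP f = (\<Sum>s\<in>S. smul (complex_of_real (c s)) (ofP s))"
      by (simp add: ofP_sum ofP_smul)
    also have "\<dots> \<in> poly3.span (ofP ` S)"
      by (intro poly3.span_sum poly3.span_scale poly3.span_base) auto
    finally show ?thesis .
  qed
  show "poly3.span (ofP ` S) = {p. reP p \<in> poly3.span S \<and> imP p \<in> poly3.span S}"
  proof (intro set_eqI iffI)
    fix p assume "p \<in> poly3.span (ofP ` S)"
    then obtain c where "p = (\<Sum>x\<in>ofP ` S. smul (c x) x)"
      unfolding poly3.span_finite[OF fin'] by auto
    then have "p = (\<Sum>s\<in>S. smul (c (ofP s)) (ofP s))"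
      by (simp add: sum.reindex[OF inj])
    then show "p \<in> {p. reP p \<in> poly3.span S \<and> imP p \<in> poly3.span S}"
      unfolding mem_Collect_eq
      by (simp only: parts) (intro conjI poly3.span_sum poly3.span_scale poly3.span_base)
  next
    fix p assume "p \<in> {p. reP p \<in> poly3.span S \<and> imP p \<in> poly3.span S}"
    then have "ofP (reP p) + smul \<i> (ofP (imP p)) \<in> poly3.span (ofP ` S)"
      by (intro poly3.span_add poly3.span_scale of_span) auto
    then show "p \<in> poly3.span (ofP ` S)" using complex_split[of p] by simp
  qed
qed

subsection \<open>Gorenstein ideals and positive functionals\<close>

text \<open>Over the ring itself, subspaces are ideals, and \<open>span\<close> is the generated
  ideal of \<open>gorenstein_ideal\<close>.\<close>

interpretation poly3_ring: module "(*) :: complex poly3 \<Rightarrow> complex poly3 \<Rightarrow> complex poly3"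
  by standard (auto simp: algebra_simps)

lemma Lin_zero_degree:
  assumes "\<And>k. tdeg k \<noteq> n \<Longrightarrow> \<phi> k = 0" "p \<in> forms m" "m \<noteq> n"
  shows "Lin \<phi> p = 0"
  using assms by (auto simp: Lin_def forms_keys simp del: split_paired_All intro!: sum.neutral)

text \<open>Generating an ideal adds no new forms in degrees up to \<open>n\<close>: the polynomials
  all of whose multiples are killed by \<open>Lin \<phi>\<close> already form an ideal, and it
  contains every generator.\<close>

lemma gorenstein_iff:
  fixes \<phi> :: "nat \<times> nat \<times> nat \<Rightarrow> complex"
  assumes \<phi>: "\<And>k. tdeg k \<noteq> n \<Longrightarrow> \<phi> k = 0" and L: "\<And>p. p \<in> forms n \<Longrightarrow> l p = Lin \<phi> p"
    and p: "p \<in> forms i" "i \<le> n"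
  shows "p \<in> gorenstein_ideal n l \<longleftrightarrow> (\<forall>q\<in>forms (n - i). Lin \<phi> (p * q) = 0)"
proof
  assume R: "\<forall>q\<in>forms (n - i). Lin \<phi> (p * q) = 0"
  have "l (p * q) = 0" if "q \<in> forms (n - i)" for q
    using R that L[of "p * q"] forms_mult[OF p(1) that] p(2) by simp
  then show "p \<in> gorenstein_ideal n l"
    unfolding gorenstein_ideal_def using p by (intro poly3_ring.span_base) blast
next
  let ?G = "{p. \<exists>k. p \<in> forms k \<and> (k > n \<or> (\<forall>q\<in>forms (n - k). l (p * q) = 0))}"
  let ?J = "{p. \<forall>q. Lin \<phi> (p * q) = 0}"
  have "poly3_ring.subspace ?J"
    by (auto simp: poly3_ring.subspace_def distrib_right Lin_add) (metis mult.assoc mult.commute)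
  moreover have "?G \<subseteq> ?J"
  proof (intro subsetI CollectI allI)
    fix g q assume "g \<in> ?G"
    then obtain k where k: "g \<in> forms k" "k > n \<or> (\<forall>q\<in>forms (n - k). l (g * q) = 0)" by auto
    \<comment> \<open>Only products of degree \<open>n\<close> matter, since \<open>\<phi>\<close>
      is 0 in all other degrees; this also disposes of generators of degree above
      \<open>n\<close>.\<close>
    have m: "Lin \<phi> (g * mon j) = 0" for j
    proof (cases "k + tdeg j = n")
      case True
      then have "mon j \<in> (forms (n - k) :: complex poly3 set)" by (intro forms_single) simp
      moreover from this have "g * mon j \<in> forms n"
        using forms_mult[OF k(1)] True by fastforce
      ultimately show ?thesis using k(2) True L by auto
    next
      case False
      then show ?thesis
        using forms_mult[OF k(1) forms_single[OF refl, of j 1]] by (intro Lin_zero_degree[OF \<phi>]) auto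
    qed
    have "g * q = (\<Sum>j\<in>Poly_Mapping.keys q. smul (cf q j) (g * mon j))"
      by (subst poly3_expand[of "Poly_Mapping.keys q" q]) (simp_all add: sum_distrib_left smul_mult_right)
    then show "Lin \<phi> (g * q) = 0"
      by (simp add: Lin_sum Lin_smul m)
  qed
  ultimately have "gorenstein_ideal n l \<subseteq> ?J"
    unfolding gorenstein_ideal_def by (rule poly3_ring.span_minimal[rotated])
  then show "p \<in> gorenstein_ideal n l \<Longrightarrow> \<forall>q\<in>forms (n - i). Lin \<phi> (p * q) = 0"
    by blast
qed

lemma subspace_gorenstein: "poly3.subspace (gorenstein_ideal n l)"
  unfolding poly3.subspace_def gorenstein_ideal_def smul_def
  by (auto intro: poly3_ring.span_zero poly3_ring.span_add poly3_ring.span_scale)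

lemma form_dual_add: "l \<in> form_dual m \<Longrightarrow> p \<in> forms m \<Longrightarrow> q \<in> forms m \<Longrightarrow> l (p + q) = l p + l q"
  by (simp add: form_dual_def)

lemma form_dual_sum:
  assumes "l \<in> form_dual m" "\<And>i. i \<in> I \<Longrightarrow> f i \<in> forms m"
  shows "l (\<Sum>i\<in>I. smul (r i) (f i)) = (\<Sum>i\<in>I. r i * l (f i))"
proof -
  have "l 0 = 0"
    using assms(1) unfolding form_dual_def by (metis (mono_tags, lifting) mem_Collect_eq add_0 add_cancel_left_left forms_0)
  then show ?thesis
    using assms(2)
  proof (induction I rule: infinite_finite_induct)
    case (insert x F)
    then show ?case
      using assms(1) forms_sum[of F "\<lambda>i. smul (r i) (f i)" m]
      by (auto simp: form_dual_def forms_smul)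
  qed auto
qed

text \<open>An isotropic vector of a positive semidefinite form lies in its radical: along
  \<open>g + t f\<close> the quadratic form is affine in \<open>t\<close> and bounded below, so its
  slope is 0.\<close>

lemma sos_dual_null:
  assumes l: "l \<in> sos_dual d" and f: "f \<in> forms d" and g: "g \<in> forms d" and z: "l (f * f) = 0"
  shows "l (f * g) = 0"
proof (rule ccontr)
  assume n: "l (f * g) \<noteq> 0"
  have ld: "l \<in> form_dual (2 * d)" and pos: "\<And>h. h \<in> forms d \<Longrightarrow> l (h * h) \<ge> 0"
    using l by (auto simp: sos_dual_def bilin_def)
  \<comment> \<open>The parameter at which the affine function takes the value -1.\<close>
  define t where "t = - (l (g * g) + 1) / (2 * l (f * g))"
  have p: "f * g \<in> forms (2 * d)" "g * g \<in> forms (2 * d)" "f * f \<in> forms (2 * d)"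
    using forms_mult[OF f g] forms_mult[OF g g] forms_mult[OF f f] by (simp_all add: mult_2)
  have sm: "l (smul r h) = r * l h" if "h \<in> forms (2 * d)" for r h
    using ld that by (simp add: form_dual_def)
  have dbl: "smul (2 * t) (f * g) = smul t (f * g) + smul t (f * g)"
    unfolding mult_2 by (rule poly3.scale_left_distrib)
  have "(g + smul t f) * (g + smul t f) = g * g + (smul (2 * t) (f * g) + smul (t * t) (f * f))"
    by (simp add: distrib_left distrib_right smul_mult_left smul_mult_right mult.commute[of g f]
      poly3.scale_right_distrib dbl add_ac)
  then have "l ((g + smul t f) * (g + smul t f)) = l (g * g) + 2 * t * l (f * g) + t * t * l (f * f)"
    using p by (simp add: form_dual_add[OF ld] forms_add forms_smul sm)
  also have "\<dots> = - 1"
    using n z by (simp add: t_def field_simps)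
  finally show False
    using pos[of "g + smul t f"] f g by (simp add: forms_add forms_smul)
qed

subsection \<open>The grid\<close>

locale grid_config =
  fixes d :: nat
  assumes d4: "d \<ge> 4"
begin

text \<open>With the node 1/2, \<open>x + y\<close> is not an integer at grid points with exactly
  one half coordinate, so these avoid all lines \<open>x + y = k z\<close> with integral
  \<open>k\<close>.\<close>

definition X :: "real set" where
  "X = insert (1/2) (real ` {..d - 2})"

definition pt :: "nat \<times> nat \<Rightarrow> real \<times> real \<times> real" where
  "pt = (\<lambda>(i, j). (real i, real j, 1))"

text \<open>The coordinates of \<open>star\<close> add up to 1, so that \<open>L (0, 0)\<close> below vanishes there.\<close>

definition star :: "real \<times> real \<times> real" where
  "star = (1/2, 1/2, 1)"

definition grid :: "(real \<times> real \<times> real) set" where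
  "grid = (\<lambda>(x, y). (x, y, 1)) ` (X \<times> X)"

definition T :: "(real \<times> real \<times> real) set" where
  "T = pt ` {(i, j). i + j \<le> d - 3}"

lemma half_not_nat: "1/2 \<noteq> real i" "1/2 - real i \<noteq> 0" "real i \<noteq> 1/2"
proof -
  have "2 * real i \<noteq> 1"
    by (metis of_nat_mult of_nat_numeral of_nat_eq_1_iff nat_mult_eq_1_iff num.distinct(1) numeral_eq_one_iff)
  then show "1/2 \<noteq> real i" "1/2 - real i \<noteq> 0" "real i \<noteq> 1/2" by auto
qed

lemma finite_X: "finite X" and card_X: "card X = d"
  using d4 half_not_nat by (auto simp: X_def card_insert_if card_image image_iff)

lemma finite_grid [simp]: "finite grid"
  by (simp add: grid_def finite_X)

lemma card_grid: "card grid = d * d"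
  unfolding grid_def by (subst card_image) (auto simp: inj_on_def card_X card_cartesian_product)

lemma T_subset: "T \<subseteq> grid"
  using d4 by (auto simp: T_def grid_def pt_def X_def image_iff)

lemma inj_pt: "inj_on pt A"
  by (auto simp: inj_on_def pt_def)

lemma card_T: "card T = (d - 1) choose 2"
proof -
  have "d - 3 + 2 = d - 1" using d4 by simp
  then show ?thesis
    unfolding T_def by (simp only: card_image[OF inj_pt] card_triangle)
qed

lemma star_grid: "star \<in> grid - T"
  using half_not_nat by (auto simp: star_def grid_def X_def T_def pt_def)

section \<open>The Cayley-Bacharach relation of the grid\<close>

definition \<omega> :: "real \<Rightarrow> real" where
  "\<omega> = (SOME \<omega>. (\<forall>x\<in>X. \<omega> x \<noteq> 0) \<and> (\<forall>k. Suc k < d \<longrightarrow> (\<Sum>x\<in>X. \<omega> x * x ^ k) = 0))"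

lemma \<omega>: "x \<in> X \<Longrightarrow> \<omega> x \<noteq> 0" "Suc k < d \<Longrightarrow> (\<Sum>x\<in>X. \<omega> x * x ^ k) = 0"
  using someI_ex[OF divided_difference_weights[OF finite_X]] unfolding \<omega>_def card_X by blast+

definition w :: "real \<times> real \<times> real \<Rightarrow> real" where
  "w = (\<lambda>(x, y, z). \<omega> x * \<omega> y)"

lemma w_nonzero: "P \<in> grid \<Longrightarrow> w P \<noteq> 0"
  by (auto simp: w_def grid_def \<omega>)

text \<open>On a monomial the sum factors into one sum over \<open>x\<close> and one over
  \<open>y\<close>. The exponents of \<open>x\<close> and \<open>y\<close> add up to at most
  \<open>2 * d - 3\<close>, so one of them is below \<open>d - 1\<close> and its factor
  vanishes.\<close>

lemma grid_relation:
  assumes "f \<in> forms m" "m + 3 \<le> 2 * d"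
  shows "(\<Sum>P\<in>grid. w P * ev P f) = 0"
proof -
  have mono: "(\<Sum>P\<in>grid. w P * ev P (mon k)) = 0" if k: "k \<in> exps m" for k
  proof -
    obtain a b c where abc: "k = (a, b, c)" by (cases k)
    have "(\<Sum>P\<in>grid. w P * ev P (mon k)) = (\<Sum>(x, y)\<in>X \<times> X. (\<omega> x * x ^ a) * (\<omega> y * y ^ b))"
      unfolding grid_def by (subst sum.reindex) (auto simp: inj_on_def w_def abc ev_single intro!: sum.cong)
    also have "\<dots> = (\<Sum>x\<in>X. \<omega> x * x ^ a) * (\<Sum>y\<in>X. \<omega> y * y ^ b)"
      by (simp add: sum_product sum.cartesian_product)
    also have "\<dots> = 0"
    proof -
      have "Suc a < d \<or> Suc b < d"
        using k assms(2) by (auto simp: exps_def abc)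
      then show ?thesis using \<omega> by auto
    qed
    finally show ?thesis .
  qed
  have "(\<Sum>P\<in>grid. w P * ev P f) = (\<Sum>P\<in>grid. \<Sum>k\<in>exps m. cf f k * (w P * ev P (mon k)))"
    by (simp add: ev_expand[OF assms(1)] sum_distrib_left mult.left_commute)
  also have "\<dots> = (\<Sum>k\<in>exps m. cf f k * (\<Sum>P\<in>grid. w P * ev P (mon k)))"
    by (subst sum.swap) (simp add: sum_distrib_left)
  also have "\<dots> = 0"
    using mono by simp
  finally show ?thesis .
qed

text \<open>An unnormalised Lagrange basis of the forms of degree \<open>d - 3\<close> on the triangle \<open>T\<close>.\<close>

definition L :: "nat \<times> nat \<Rightarrow> real poly3" where
  "L = (\<lambda>(i, j). (\<Prod>a<i. lf 1 0 (- real a)) * (\<Prod>b<j. lf 0 1 (- real b))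
     * (\<Prod>c<d - 3 - i - j. lf (-1) (-1) (real (d - 3 - c))))"

lemma ev_L: "ev (x, y, 1) (L (i, j)) = (\<Prod>a<i. x - real a) * (\<Prod>b<j. y - real b)
     * (\<Prod>c<d - 3 - i - j. real (d - 3 - c) - x - y)"
  by (simp add: L_def ev_mult ev_prod algebra_simps)

lemma L_forms:
  assumes "i + j \<le> d - 3"
  shows "L (i, j) \<in> forms (d - 3)"
proof -
  have "L (i, j) \<in> forms (card {..<i} + card {..<j} + card {..<d - 3 - i - j})"
    unfolding L_def prod.case by (intro forms_mult forms_prod) simp_all
  moreover have "card {..<i} + card {..<j} + card {..<d - 3 - i - j} = d - 3"
    using assms by simp
  ultimately show ?thesis
    by (simp only:)
qed

lemma L_self: "i + j \<le> d - 3 \<Longrightarrow> ev (pt (i, j)) (L (i, j)) \<noteq> 0"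
  by (auto simp: pt_def ev_L of_nat_diff)

text \<open>A smaller first or second coordinate puts the point on a vertical or horizontal line of
  the product; otherwise its coordinate sum is larger and it lies on a diagonal line.\<close>

lemma L_other:
  assumes "i + j \<le> d - 3" "i' + j' \<le> d - 3" "(i', j') \<noteq> (i, j)"
  shows "ev (pt (i', j')) (L (i, j)) = 0"
proof -
  consider "i' < i" | "j' < j" | "i' + j' > i + j"
    using assms by force
  then show ?thesis
  proof cases
    case 3
    then have "d - 3 - i' - j' < d - 3 - i - j"
      using assms by simp
    moreover have "real (d - 3 - (d - 3 - i' - j')) - real i' - real j' = 0"
      using assms by simp
    ultimately show ?thesis
      by (force simp: pt_def ev_L)
  qed (auto simp: pt_def ev_L)
qed

text \<open>The only candidate for a line through \<open>star\<close> is the diagonal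
  \<open>x + y = z\<close>, which is the factor \<open>c = d - 4\<close>. It occurs exactly when
  \<open>d - 4 < d - 3 - i - j\<close>; for \<open>L (0, 0)\<close> this uses
  \<open>d \<ge> 4\<close>.\<close>

lemma L_star: "i + j \<le> d - 3 \<Longrightarrow> ev star (L (i, j)) = 0 \<longleftrightarrow> i = 0 \<and> j = 0"
proof -
  assume ij: "i + j \<le> d - 3"
  have "(\<exists>c<d - 3 - i - j. real (d - 3 - c) - 1/2 - 1/2 = 0) \<longleftrightarrow> i = 0 \<and> j = 0"
  proof
    assume "\<exists>c<d - 3 - i - j. real (d - 3 - c) - 1/2 - 1/2 = 0"
    then show "i = 0 \<and> j = 0" by auto
  next
    assume "i = 0 \<and> j = 0"
    then show "\<exists>c<d - 3 - i - j. real (d - 3 - c) - 1/2 - 1/2 = 0"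
      using d4 by (intro exI[of _ "d - 4"]) (auto simp: of_nat_diff)
  qed
  moreover have "ev star (L (i, j)) = 0 \<longleftrightarrow> (\<exists>c<d - 3 - i - j. real (d - 3 - c) - 1/2 - 1/2 = 0)"
    unfolding star_def ev_L mult_eq_0_iff
    using half_not_nat by (auto simp only: prod_zero_iff finite_lessThan lessThan_iff Bex_def)
  ultimately show ?thesis
    by (simp only:)
qed

text \<open>The lines are \<open>x + y = k z\<close> with \<open>1 \<le> k \<le> d - 3\<close>. A
  grid point on one of them has integral coordinate sum, so it is \<open>star\<close> or a point of
  \<open>T\<close> other than the origin.\<close>

lemma L00_nonzero:
  assumes "P \<in> grid" "P \<notin> T \<or> P = pt (0, 0)" "P \<noteq> star"
  shows "ev P (L (0, 0)) \<noteq> 0"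
proof -
  obtain x y where P: "P = (x, y, 1)" "x \<in> X" "y \<in> X"
    using assms by (auto simp: grid_def)
  have half: "(\<exists>m::nat. x + y = real m + 1/2) \<or> (\<exists>i j. x = real i \<and> y = real j)"
  proof -
    have "x = 1/2 \<or> (\<exists>i. x = real i)" "y = 1/2 \<or> (\<exists>j. y = real j)" "x \<noteq> 1/2 \<or> y \<noteq> 1/2"
      using P assms(3) by (auto simp: X_def star_def)
    then show ?thesis
      by (metis add.commute)
  qed
  have "real (d - 3 - c) - x - y \<noteq> 0" if c: "c < d - 3" for c
  proof
    assume z: "real (d - 3 - c) - x - y = 0"
    from half show False
    proof
      assume "\<exists>m::nat. x + y = real m + 1/2"
      then obtain m :: nat where "x + y = real m + 1/2" by blast
      \<comment> \<open>Doubled, the equation equates an even and an odd number.\<close>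
      with z have "real (2 * (d - 3 - c)) = real (2 * m + 1)" by (simp add: of_nat_diff)
      then have "2 * (d - 3 - c) = 2 * m + 1" by (simp only: of_nat_eq_iff)
      then show False by presburger
    next
      assume "\<exists>i j. x = real i \<and> y = real j"
      then obtain i j where ij: "x = real i" "y = real j" by blast
      with z have "real (d - 3 - c) = real (i + j)" by simp
      then have s: "d - 3 - c = i + j" by (simp only: of_nat_eq_iff)
      then have "P \<in> T" using c ij P by (auto simp: T_def pt_def image_iff)
      then have "P = pt (0, 0)" using assms by auto
      then show False using s c ij P by (auto simp: pt_def)
    qed
  qed
  then show ?thesis by (simp add: P ev_L)
qed

lemma star_neq_pt: "star \<noteq> pt k"
  using half_not_nat by (cases k) (auto simp: star_def pt_def)

text \<open>In the grid relation for \<open>f * L (i, j)\<close>, of degree at most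
  \<open>2 * d - 3\<close>, only the term at \<open>pt (i, j)\<close> survives.\<close>

lemma vanish_grid:
  assumes f: "f \<in> forms m" "m \<le> d" and van: "\<And>P. P \<in> grid - T \<Longrightarrow> ev P f = 0" and P: "P \<in> grid"
  shows "ev P f = 0"
proof (cases "P \<in> T")
  case True
  then obtain i j where ij: "P = pt (i, j)" "i + j \<le> d - 3" by (auto simp: T_def)
  have "0 = (\<Sum>Q\<in>grid. w Q * ev Q (f * L (i, j)))"
    using f d4 by (intro grid_relation[symmetric, OF forms_mult[OF f(1) L_forms[OF ij(2)]]]) auto
  also have "\<dots> = (\<Sum>Q\<in>{P}. w Q * ev Q (f * L (i, j)))"
  proof (rule sum.mono_neutral_right)
    show "\<forall>Q\<in>grid - {P}. w Q * ev Q (f * L (i, j)) = 0"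
    proof
      fix Q assume Q: "Q \<in> grid - {P}"
      show "w Q * ev Q (f * L (i, j)) = 0"
      proof (cases "Q \<in> T")
        case True
        then show ?thesis using Q ij L_other[OF ij(2)] by (auto simp: T_def ev_mult)
      next
        case False
        then show ?thesis using Q van by (simp add: ev_mult)
      qed
    qed
  qed (use P in auto)
  finally show ?thesis
    using w_nonzero[OF P] L_self[OF ij(2)] by (simp add: ev_mult ij)
next
  case False
  then show ?thesis using van P by blast
qed

section \<open>Forms of degree \<open>d\<close> are determined by their values on
  \<open>base\<close>\<close>

lemma ev_X_axis:
  assumes "f \<in> forms m" shows "ev (1, 0, 0) f = cf f (m, 0, 0)" "ev (0, 1, 0) f = cf f (0, m, 0)"
proof -
  have "ev (1, 0, 0) f = (\<Sum>k\<in>exps m. if k = (m, 0, 0) then cf f k else 0)"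
    unfolding ev_expand[OF assms] by (intro sum.cong) (auto simp: ev_single exps_def zero_power_eq power_0_left split: if_splits)
  then show "ev (1, 0, 0) f = cf f (m, 0, 0)"
    by (subst (asm) sum.delta[OF finite_exps]) (simp_all add: exps_def)
  have "ev (0, 1, 0) f = (\<Sum>k\<in>exps m. if k = (0, m, 0) then cf f k else 0)"
    unfolding ev_expand[OF assms] by (intro sum.cong) (auto simp: ev_single exps_def zero_power_eq power_0_left split: if_splits)
  then show "ev (0, 1, 0) f = cf f (0, m, 0)"
    by (subst (asm) sum.delta[OF finite_exps]) (simp_all add: exps_def)
qed

lemma poly_vanish_X:
  assumes "\<And>x. x \<in> X \<Longrightarrow> (\<Sum>a<d. c a * x ^ a) = 0" "a < d"
  shows "c a = (0::real)"
proof -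
  define p where "p = Poly (map c [0..<d])"
  have cp: "coeff p a = (if a < d then c a else 0)" for a
    by (auto simp: p_def nth_default_def)
  have ppoly: "poly p x = (\<Sum>a<d. c a * x ^ a)" for x
  proof -
    have "degree p < d \<or> p = 0"
      using cp by (metis leading_coeff_0_iff)
    then have "poly p x = (\<Sum>a<d. coeff p a * x ^ a)"
      unfolding poly_altdef
      using d4 by (intro sum.mono_neutral_left) (auto simp: coeff_eq_0)
    then show ?thesis by (simp add: cp)
  qed
  have "p = 0"
  proof (rule ccontr)
    assume "p \<noteq> 0"
    then have "degree p < d" using cp by (metis leading_coeff_0_iff)
    moreover have "card {x. poly p x = 0} \<le> degree p"
      using \<open>p \<noteq> 0\<close> by (rule card_poly_roots_bound)
    moreover have "card X \<le> card {x. poly p x = 0}"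
      using assms ppoly poly_roots_finite[OF \<open>p \<noteq> 0\<close>] by (intro card_mono) auto
    ultimately show False by (simp add: card_X)
  qed
  then show ?thesis using cp[of a] assms by simp
qed

text \<open>At \<open>z = 1\<close> the form becomes a polynomial of degree below \<open>d\<close>
  in each of \<open>x\<close> and \<open>y\<close>. Since \<open>X\<close> has \<open>d\<close>
  points, one variable after the other is eliminated; homogeneity restores the exponent of
  \<open>z\<close>.\<close>

lemma reduced_vanish:
  assumes f: "f \<in> forms m" and red: "\<And>a b c. cf f (a, b, c) \<noteq> 0 \<Longrightarrow> a < d \<and> b < d"
    and van: "\<And>P. P \<in> grid \<Longrightarrow> ev P f = 0"
  shows "f = 0"
proof -
  define g where "g a b = (if a + b \<le> m then cf f (a, b, m - a - b) else 0)" for a b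
  have ev: "ev (x, y, 1) f = (\<Sum>b<d. (\<Sum>a<d. g a b * x ^ a) * y ^ b)" for x y
  proof -
    have "ev (x, y, 1) f = (\<Sum>k\<in>Poly_Mapping.keys f. cf f k * (case k of (a, b, c) \<Rightarrow> x ^ a * y ^ b))"
      by (auto simp: ev_def Lin_def intro!: sum.cong)
    \<comment> \<open>For \<open>a + b > m\<close> the truncated difference gives a triple of the
      wrong degree; the test on \<open>tdeg\<close> assigns it the coefficient 0.\<close>
    also have "\<dots> = (\<Sum>k\<in>(\<lambda>(a, b). (a, b, m - a - b)) ` ({..<d} \<times> {..<d}).
        (if tdeg k = m then cf f k else 0) * (case k of (a, b, c) \<Rightarrow> x ^ a * y ^ b))"
    proof (rule sum.mono_neutral_cong_left)
      show "Poly_Mapping.keys f \<subseteq> (\<lambda>(a, b). (a, b, m - a - b)) ` ({..<d} \<times> {..<d})"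
        using f red by (fastforce simp: in_keys_iff forms_iff image_iff)
      show "\<And>k. k \<in> Poly_Mapping.keys f \<Longrightarrow> cf f k * (case k of (a, b, c) \<Rightarrow> x ^ a * y ^ b)
        = (if tdeg k = m then cf f k else 0) * (case k of (a, b, c) \<Rightarrow> x ^ a * y ^ b)"
        using f by (auto simp: forms_keys)
    qed (auto simp: in_keys_iff)
    also have "\<dots> = (\<Sum>(a, b)\<in>{..<d} \<times> {..<d}. g a b * x ^ a * y ^ b)"
      by (subst sum.reindex) (auto simp: inj_on_def g_def intro!: sum.cong)
    also have "\<dots> = (\<Sum>b<d. \<Sum>a<d. g a b * x ^ a * y ^ b)"
      by (subst sum.swap) (simp add: sum.cartesian_product)
    finally show ?thesis
      by (simp add: sum_distrib_right)
  qed
  have "g a b = 0" if "a < d" "b < d" for a b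
  proof (rule poly_vanish_X[of "\<lambda>a. g a b"])
    fix x assume x: "x \<in> X"
    show "(\<Sum>a<d. g a b * x ^ a) = 0"
    proof (rule poly_vanish_X[of "\<lambda>b. \<Sum>a<d. g a b * x ^ a"])
      fix y assume "y \<in> X"
      then show "(\<Sum>b<d. (\<Sum>a<d. g a b * x ^ a) * y ^ b) = 0"
        using x van[of "(x, y, 1)"] by (simp add: grid_def image_iff ev[symmetric])
    qed (fact that)
  qed (fact that)
  then have "cf f (a, b, c) = 0" for a b c
    using f red[of a b c] by (force simp: g_def forms_iff)
  then show ?thesis
    by (auto intro: poly_mapping_eqI)
qed

text \<open>
  The two points at infinity stand for the coefficients of \<open>x^d\<close> and \<open>y^d\<close>.
\<close>

definition base :: "(real \<times> real \<times> real) set" where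
  "base = insert (1, 0, 0) (insert (0, 1, 0) (grid - T))"

lemma finite_base [simp]: "finite base"
  by (simp add: base_def)

text \<open>By \<open>vanish_grid\<close> the form vanishes on the whole grid, and without
  \<open>x^d\<close> and \<open>y^d\<close> its exponents are small enough for
  \<open>reduced_vanish\<close>.\<close>

lemma base_injective:
  assumes f: "f \<in> forms d" and van: "\<And>P. P \<in> base \<Longrightarrow> ev P f = 0"
  shows "f = 0"
proof (rule reduced_vanish[OF f])
  show "ev P f = 0" if "P \<in> grid" for P
    using vanish_grid[OF f] van that by (auto simp: base_def)
  show "a < d \<and> b < d" if "cf f (a, b, c) \<noteq> 0" for a b c
  proof -
    have s: "a + b + c = d"
      using f that by (auto simp: forms_iff)
    moreover have "cf f (d, 0, 0) = 0" "cf f (0, d, 0) = 0"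
      using van ev_X_axis[OF f] by (auto simp: base_def)
    ultimately show ?thesis using that by (cases "a = d"; cases "b = d") auto
  qed
qed

lemma card_base: "card base = (d + 2) choose 2"
proof -
  have "card (grid - T) = d * d - ((d - 1) choose 2)"
    using T_subset by (simp add: card_Diff_subset finite_subset card_grid card_T)
  moreover have "(1, 0, 0) \<notin> grid - T" "(0, 1, 0) \<notin> grid - T"
    by (auto simp: grid_def)
  ultimately have "card base = d * d - ((d - 1) choose 2) + 2"
    by (simp add: base_def)
  \<comment> \<open>With \<open>d = n + 3\<close> the count
    \<open>d^2 + 2 = ((d - 1) choose 2) + ((d + 2) choose 2)\<close> is free of truncated
    subtraction.\<close>
  moreover obtain n where "d = 3 + n"
    using d4 le_Suc_ex[of 3 d] by auto
  moreover have "(3 + n) * (3 + n) + 2 = ((n + 2) choose 2) + ((n + 5) choose 2)"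
    by (induction n) (auto simp: eval_nat_numeral)
  moreover have "(d - 1) choose 2 \<le> d * d"
    using card_mono[OF finite_grid T_subset] by (simp add: card_T card_grid)
  ultimately show ?thesis by (simp add: add.commute)
qed

subsection \<open>The functional and its kernel\<close>

definition e :: "real \<times> real \<times> real \<Rightarrow> real poly3" where
  "e = (SOME e. \<forall>P\<in>base. e P \<in> forms d \<and> (\<forall>Q\<in>base. ev Q (e P) = (if P = Q then 1 else 0)))"

lemma e_forms: "P \<in> base \<Longrightarrow> e P \<in> forms d"
  and ev_e: "P \<in> base \<Longrightarrow> Q \<in> base \<Longrightarrow> ev Q (e P) = (if P = Q then 1 else 0)"
proof -
  have "\<exists>e. \<forall>P\<in>base. e P \<in> forms d \<and> (\<forall>Q\<in>base. ev Q (e P) = (if P = Q then 1 else 0))"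
    using finite_base card_base ev_add ev_smul base_injective by (rule dual_basis_forms)
  from someI_ex[OF this] show "P \<in> base \<Longrightarrow> e P \<in> forms d"
    "P \<in> base \<Longrightarrow> Q \<in> base \<Longrightarrow> ev Q (e P) = (if P = Q then 1 else 0)"
    unfolding e_def by blast+
qed

definition q0 :: "real \<times> real \<times> real" where
  "q0 = pt (0, 0)"

definition Z :: "(real \<times> real \<times> real) set" where
  "Z = grid - T - {star}"

text \<open>Here \<open>L (0, 0)\<close> is the product of diagonal lines that weights the
  Cayley-Bacharach relation.\<close>

definition c :: "real \<times> real \<times> real \<Rightarrow> real" where
  "c P = w P * ev P (L (0, 0))"

definition M :: real where
  "M = real (card Z)"

lemma finite_Z [simp]: "finite Z"
  by (simp add: Z_def)

lemma Z_base: "Z \<subseteq> base"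
  by (auto simp: Z_def base_def)

lemma q0_T: "q0 \<in> T"
  by (auto simp: q0_def T_def)

lemma q0_Z [simp]: "q0 \<notin> Z"
  using q0_T by (auto simp: Z_def)

lemma c_nonzero: "P \<in> Z \<Longrightarrow> c P \<noteq> 0" "c q0 \<noteq> 0"
proof -
  show "P \<in> Z \<Longrightarrow> c P \<noteq> 0"
    using w_nonzero L00_nonzero[of P] by (auto simp: c_def Z_def)
  show "c q0 \<noteq> 0"
    using w_nonzero[of q0] L00_nonzero[of q0] subsetD[OF T_subset q0_T] star_neq_pt[of "(0, 0)"]
    unfolding c_def q0_def by (metis mult_eq_0_iff)
qed

lemma grid_iff: "(x, y, 1) \<in> grid \<longleftrightarrow> x \<in> X \<and> y \<in> X"
  by (auto simp: grid_def)

text \<open>Two points of \<open>Z\<close> with different \<open>x/z\<close>. They show that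
  \<open>Z\<close> is not empty, that \<open>\<Lambda>\<close> is positive on some square, and that
  \<open>x/z\<close> is not constant on \<open>Z\<close>.\<close>

lemma nodes_Z: "(real (d - 2), 0, 1) \<in> Z" "(1/2, 0, 1) \<in> Z"
proof -
  have "(real (d - 2), 0, 1) \<in> grid" "(1/2, 0, 1) \<in> grid"
    unfolding grid_iff by (auto simp: X_def simp del: of_nat_diff)
  moreover have "(real (d - 2), 0, 1) \<noteq> pt (i, j)" if "i + j \<le> d - 3" for i j
  proof
    assume "(real (d - 2), 0, 1) = pt (i, j)"
    then have "d - 2 = i" unfolding pt_def by (simp only: prod.case prod.inject of_nat_eq_iff)
    then show False using that d4 by simp
  qed
  moreover have "(1/2, 0, 1) \<noteq> pt (i, j)" for i j
    using half_not_nat by (simp add: pt_def)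
  ultimately show "(real (d - 2), 0, 1) \<in> Z" "(1/2, 0, 1) \<in> Z"
    unfolding Z_def T_def star_def by auto
qed

lemma M_pos: "M > 0"
  using nodes_Z unfolding M_def by (metis card_gt_0_iff empty_iff finite_Z of_nat_0_less_iff)

text \<open>This is the grid relation for \<open>f * L (0, 0)\<close>, whose degree
  \<open>2 * d - 3\<close> is just allowed; the factor \<open>L (0, 0)\<close> removes
  \<open>star\<close> and all of \<open>T\<close> but the origin.\<close>

lemma Z_relation:
  assumes f: "f \<in> forms d"
  shows "(\<Sum>P\<in>Z. c P * ev P f) = - c q0 * ev q0 f"
proof -
  have "0 = (\<Sum>Q\<in>grid. w Q * ev Q (f * L (0, 0)))"
    using d4 by (intro grid_relation[symmetric, OF forms_mult[OF f L_forms]]) auto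
  also have "\<dots> = (\<Sum>Q\<in>insert q0 Z. w Q * ev Q (f * L (0, 0)))"
  proof (rule sum.mono_neutral_right)
    show "\<forall>Q\<in>grid - insert q0 Z. w Q * ev Q (f * L (0, 0)) = 0"
    proof
      fix Q assume "Q \<in> grid - insert q0 Z"
      then consider "Q = star" | "Q \<in> T" "Q \<noteq> pt (0, 0)"
        by (auto simp: Z_def q0_def)
      then show "w Q * ev Q (f * L (0, 0)) = 0"
      proof cases
        case 1
        then show ?thesis using L_star[of 0 0] by (simp add: ev_mult)
      next
        case 2
        then obtain i' j' where Q: "Q = pt (i', j')" "i' + j' \<le> d - 3"
          by (auto simp: T_def)
        then have "(i', j') \<noteq> (0, 0)"
          using 2 by metis
        then show ?thesis using L_other[of 0 0 i' j'] Q by (simp add: ev_mult)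
      qed
    qed
  qed (use q0_T T_subset Z_def in auto)
  also have "\<dots> = c q0 * ev q0 f + (\<Sum>P\<in>Z. c P * ev P f)"
    by (simp add: c_def ev_mult mult_ac)
  finally show ?thesis by simp
qed

text \<open>
  With \<open>\<Sum>P\<in>Z. c P * ev P f = - c q0 * ev q0 f\<close>, the weight at \<open>q0\<close> makes \<open>\<Lambda> (f * f)\<close> the sum of
  squared deviations of the numbers \<open>c P * ev P f\<close> from their mean.
\<close>

definition \<Lambda> :: "real poly3 \<Rightarrow> real" where
  "\<Lambda> g = (\<Sum>P\<in>Z. (c P)\<^sup>2 * ev P g) - (c q0)\<^sup>2 / M * ev q0 g"

lemma \<Lambda>_add: "\<Lambda> (f + g) = \<Lambda> f + \<Lambda> g"
  and \<Lambda>_smul: "\<Lambda> (smul r f) = r * \<Lambda> f"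
  by (simp_all add: \<Lambda>_def ev_add ev_smul algebra_simps add_divide_distrib sum.distrib sum_distrib_left)

definition mean :: "real poly3 \<Rightarrow> real" where
  "mean f = (\<Sum>P\<in>Z. c P * ev P f) / M"

text \<open>A covariance formula: \<open>Z_relation\<close> for \<open>f\<close> and for
  \<open>g\<close> turns the term at \<open>q0\<close> into \<open>mean f\<close> times the sum for
  \<open>g\<close>.\<close>

lemma \<Lambda>_mult:
  assumes "f \<in> forms d" "g \<in> forms d"
  shows "\<Lambda> (f * g) = (\<Sum>P\<in>Z. (c P * ev P f - mean f) * (c P * ev P g))"
proof -
  have "(c q0)\<^sup>2 / M * ev q0 (f * g) = (- c q0 * ev q0 f) * (- c q0 * ev q0 g) / M"
    by (simp add: ev_mult power2_eq_square)
  also have "\<dots> = mean f * (\<Sum>P\<in>Z. c P * ev P g)"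
    using assms by (simp add: mean_def Z_relation)
  finally show ?thesis
    by (simp add: \<Lambda>_def ev_mult sum_subtractf sum_distrib_left power2_eq_square algebra_simps)
qed

lemma \<Lambda>_square:
  assumes "f \<in> forms d"
  shows "\<Lambda> (f * f) = (\<Sum>P\<in>Z. (c P * ev P f - mean f)\<^sup>2)"
proof -
  \<comment> \<open>Deviations from the mean add up to 0, so the mean may be subtracted in the
    second factor as well.\<close>
  have "(\<Sum>P\<in>Z. (c P * ev P f - mean f) * mean f) = 0"
    using M_pos by (simp add: sum_subtractf flip: sum_distrib_right) (simp add: mean_def M_def)
  then have "(\<Sum>P\<in>Z. (c P * ev P f - mean f) * (c P * ev P f))
      = (\<Sum>P\<in>Z. (c P * ev P f - mean f) * (c P * ev P f)) - (\<Sum>P\<in>Z. (c P * ev P f - mean f) * mean f)"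
    by simp
  then show ?thesis
    using assms by (simp add: \<Lambda>_mult sum_subtractf[symmetric] power2_eq_square right_diff_distrib)
qed

text \<open>The kernel of the bilinear form of \<open>\<Lambda>\<close> (see \<open>W_iff\<close>),
  written as the equality case of Cauchy-Schwarz.\<close>

definition W :: "real poly3 set" where
  "W = {f \<in> forms d. \<exists>t. \<forall>P\<in>Z. c P * ev P f = t}"

lemma W_forms: "f \<in> W \<Longrightarrow> f \<in> forms d"
  by (simp add: W_def)

lemma W_null: "f \<in> W \<Longrightarrow> g \<in> forms d \<Longrightarrow> \<Lambda> (f * g) = 0"
proof -
  assume f: "f \<in> W" and g: "g \<in> forms d"
  then obtain t where t: "\<And>P. P \<in> Z \<Longrightarrow> c P * ev P f = t"
    unfolding W_def by blast
  then have "(\<Sum>P\<in>Z. c P * ev P f) = M * t"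
    by (simp add: M_def)
  then have "mean f = t"
    using M_pos by (simp add: mean_def)
  with t show ?thesis using f g by (simp add: \<Lambda>_mult W_forms)
qed

lemma \<Lambda>_nonneg: "f \<in> forms d \<Longrightarrow> \<Lambda> (f * f) \<ge> 0"
  by (simp add: \<Lambda>_square sum_nonneg)

lemma W_I: "f \<in> forms d \<Longrightarrow> \<Lambda> (f * f) = 0 \<Longrightarrow> f \<in> W"
  by (auto simp: \<Lambda>_square sum_nonneg_eq_0_iff W_def intro!: exI[of _ "mean f"])

lemma W_iff: "f \<in> W \<longleftrightarrow> f \<in> forms d \<and> (\<forall>g\<in>forms d. \<Lambda> (f * g) = 0)"
  using W_I W_null W_forms by blast

lemma vanish_W: "f \<in> forms d \<Longrightarrow> (\<And>P. P \<in> Z \<Longrightarrow> ev P f = 0) \<Longrightarrow> f \<in> W"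
  by (auto simp: W_def)

lemma vanish_q0: "f \<in> forms d \<Longrightarrow> (\<And>P. P \<in> Z \<Longrightarrow> ev P f = 0) \<Longrightarrow> ev q0 f = 0"
  using Z_relation[of f] c_nonzero by auto

section \<open>Four forms spanning the kernel\<close>

lemma expand_e:
  assumes "f \<in> forms d"
  shows "f = (\<Sum>P\<in>base. smul (ev P f) (e P))"
proof -
  have "f - (\<Sum>P\<in>base. smul (ev P f) (e P)) = 0"
  proof (rule base_injective)
    show "f - (\<Sum>P\<in>base. smul (ev P f) (e P)) \<in> forms d"
      using assms e_forms by (intro forms_diff forms_sum forms_smul)
    fix Q assume Q: "Q \<in> base"
    then have "(\<Sum>P\<in>base. ev P f * ev Q (e P)) = (\<Sum>P\<in>base. if P = Q then ev P f else 0)"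
      by (intro sum.cong) (auto simp: ev_e)
    then show "ev Q (f - (\<Sum>P\<in>base. smul (ev P f) (e P))) = 0"
      using Q by (simp add: ev_diff ev_sum ev_smul)
  qed
  then show ?thesis by simp
qed

text \<open>The kernel form with common value 1 on \<open>Z\<close>; being 0 at the other three
  points of \<open>base\<close>, it complements their dual forms.\<close>

definition fstar :: "real poly3" where
  "fstar = (\<Sum>P\<in>Z. smul (1 / c P) (e P))"

lemma fstar_forms: "fstar \<in> forms d"
  unfolding fstar_def using Z_base by (intro forms_sum forms_smul e_forms) auto

lemma ev_fstar:
  assumes "Q \<in> base" shows "ev Q fstar = (if Q \<in> Z then 1 / c Q else 0)"
proof -
  have "ev Q fstar = (\<Sum>P\<in>Z. if P = Q then 1 / c P else 0)"
    unfolding fstar_def ev_sum ev_smul using Z_base assms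
    by (intro sum.cong) (auto simp: ev_e subset_iff)
  then show ?thesis by simp
qed

lemma fstar_W: "fstar \<in> W"
  unfolding W_def using fstar_forms ev_fstar Z_base c_nonzero
  by (auto intro!: exI[of _ 1])

lemma ev_fstar_q0: "ev q0 fstar = - M / c q0"
proof -
  have "(\<Sum>P\<in>Z. c P * ev P fstar) = M"
  proof -
    have "c P * ev P fstar = 1" if "P \<in> Z" for P
      using that ev_fstar[OF subsetD[OF Z_base that]] c_nonzero(1)[OF that] by simp
    then show ?thesis by (simp add: M_def)
  qed
  then show ?thesis
    using Z_relation[OF fstar_forms] c_nonzero by (simp add: field_simps)
qed

lemma special_base: "star \<in> base" "(1, 0, 0) \<in> base" "(0, 1, 0) \<in> base"
  "star \<notin> Z" "(1, 0, 0) \<notin> Z" "(0, 1, 0) \<notin> Z"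
  "star \<noteq> (1, 0, 0)" "star \<noteq> (0, 1, 0)"
  using star_grid by (auto simp: base_def Z_def grid_def star_def)

lemma base_eq: "base = Z \<union> {star, (1, 0, 0), (0, 1, 0)}"
  using star_grid by (auto simp: base_def Z_def)

lemma e_special_W: "e star \<in> W" "e (1, 0, 0) \<in> W" "e (0, 1, 0) \<in> W"
  using special_base Z_base by (auto intro!: vanish_W e_forms simp: ev_e subset_iff)

text \<open>In the expansion over \<open>base\<close>, the part over \<open>Z\<close> depends only
  on the common value \<open>t\<close>; the coordinates at the three remaining points are
  free.\<close>

lemma W_expand:
  assumes "f \<in> W"
  shows "\<exists>t. f = smul t fstar + smul (ev star f) (e star)
    + smul (ev (1, 0, 0) f) (e (1, 0, 0)) + smul (ev (0, 1, 0) f) (e (0, 1, 0))"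
proof -
  from assms obtain t where t: "\<And>P. P \<in> Z \<Longrightarrow> c P * ev P f = t" by (auto simp: W_def)
  have "f = (\<Sum>P\<in>Z. smul (ev P f) (e P)) + (\<Sum>P\<in>{star, (1, 0, 0), (0, 1, 0)}. smul (ev P f) (e P))"
    using expand_e[OF W_forms[OF assms]] special_base unfolding base_eq
    by (subst (asm) sum.union_disjoint) auto
  also have "(\<Sum>P\<in>Z. smul (ev P f) (e P)) = smul t fstar"
    unfolding fstar_def poly3.scale_sum_right using t c_nonzero
    by (intro sum.cong) (auto simp: field_simps)
  finally show ?thesis
    using special_base by (auto simp: add_ac intro!: exI[of _ t])
qed

text \<open>In the grid relation for \<open>f * L (i, j)\<close> all terms drop out except those at
  \<open>pt (i, j)\<close> and \<open>star\<close>, so the values of \<open>f\<close> at these two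
  points determine each other.\<close>

lemma L_times_vanish:
  assumes f: "f \<in> forms m" "m \<le> d" and ij: "i + j \<le> d - 3"
    and van: "\<And>P. P \<in> insert q0 Z \<Longrightarrow> ev P f = 0" and ne: "(i, j) \<noteq> (0, 0)"
  shows "w (pt (i, j)) * ev (pt (i, j)) f * ev (pt (i, j)) (L (i, j)) + w star * ev star f * ev star (L (i, j)) = 0"
proof -
  have pg: "pt (i, j) \<in> T" using ij by (auto simp: T_def)
  have "0 = (\<Sum>Q\<in>grid. w Q * ev Q (f * L (i, j)))"
    using f d4 by (intro grid_relation[symmetric, OF forms_mult[OF f(1) L_forms[OF ij]]]) auto
  also have "\<dots> = (\<Sum>Q\<in>{pt (i, j), star}. w Q * ev Q (f * L (i, j)))"
  proof (rule sum.mono_neutral_right)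
    show "\<forall>Q\<in>grid - {pt (i, j), star}. w Q * ev Q (f * L (i, j)) = 0"
    proof
      fix Q assume Q: "Q \<in> grid - {pt (i, j), star}"
      show "w Q * ev Q (f * L (i, j)) = 0"
      proof (cases "Q \<in> T")
        case True
        then show ?thesis using Q L_other[OF ij] by (auto simp: T_def ev_mult)
      next
        case False
        then show ?thesis using Q van by (simp add: ev_mult Z_def)
      qed
    qed
  qed (use pg T_subset star_grid in auto)
  finally show ?thesis
    using star_neq_pt[of "(i, j)"] by (auto simp: ev_mult mult_ac)
qed

lemma e_star_vanish: "P \<in> insert q0 Z \<Longrightarrow> ev P (e star) = 0"
proof -
  have *: "ev P (e star) = 0" if "P \<in> Z" for P
    using that ev_e[OF special_base(1) subsetD[OF Z_base that]] special_base(4) by auto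
  then show "P \<in> insert q0 Z \<Longrightarrow> ev P (e star) = 0"
    using vanish_q0[OF e_forms[OF special_base(1)] *] * by blast
qed

text \<open>A zero at \<open>pt (i, j)\<close> would force one at \<open>star\<close> by
  \<open>L_times_vanish\<close>, since \<open>L (i, j)\<close> is nonzero there; but
  \<open>e star\<close> has the value 1 at \<open>star\<close>.\<close>

lemma e_star_nonzero:
  assumes "i + j \<le> d - 3" "(i, j) \<noteq> (0, 0)"
  shows "ev (pt (i, j)) (e star) \<noteq> 0"
proof
  assume z: "ev (pt (i, j)) (e star) = 0"
  have "w star * ev star (e star) * ev star (L (i, j)) = 0"
    using L_times_vanish[OF e_forms[OF special_base(1)] order_refl assms(1) e_star_vanish assms(2)] z by simp
  then show False
    using L_star[OF assms(1)] assms(2) w_nonzero[of star] star_grid special_base by (auto simp: ev_e)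
qed

subsection \<open>Extremality\<close>

definition FX :: "real poly3" where "FX = (\<Prod>x\<in>X. lf 1 0 (- x))"
definition FY :: "real poly3" where "FY = (\<Prod>y\<in>X. lf 0 1 (- y))"

lemma FX_forms: "FX \<in> forms d" and FY_forms: "FY \<in> forms d"
  using forms_prod[OF finite_X, of "\<lambda>x. lf 1 0 (- x)"] forms_prod[OF finite_X, of "\<lambda>x. lf 0 1 (- x)"]
  by (auto simp: FX_def FY_def card_X)

lemma FX_grid: "P \<in> grid \<Longrightarrow> ev P FX = 0" and FY_grid: "P \<in> grid \<Longrightarrow> ev P FY = 0"
  using finite_X by (auto simp: FX_def FY_def grid_def ev_prod)

lemma FX_W: "FX \<in> W" and FY_W: "FY \<in> W"
  by (auto intro!: vanish_W FX_forms FY_forms FX_grid FY_grid simp: Z_def)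

text \<open>The outcome of division by \<open>FX\<close> and \<open>FY\<close> with reduced
  remainder. The cofactors have degree \<open>d\<close>, so that a functional whose bilinear form
  kills \<open>W\<close> kills both multiples.\<close>

definition divisible :: "real poly3 set" where
  "divisible = {FX * A + FY * B + R | A B R. A \<in> forms d \<and> B \<in> forms d \<and> R \<in> forms (2 * d) \<and>
     (\<forall>a b c. cf R (a, b, c) \<noteq> 0 \<longrightarrow> a < d \<and> b < d)}"

lemma divisible_I:
  assumes "p = FX * A + FY * B + R" "A \<in> forms d" "B \<in> forms d" "R \<in> forms (2 * d)"
    "\<And>a b c. cf R (a, b, c) \<noteq> 0 \<Longrightarrow> a < d \<and> b < d"
  shows "p \<in> divisible"
  using assms unfolding divisible_def by blast

lemma divisible_E:
  assumes "p \<in> divisible"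
  obtains A B R where "p = FX * A + FY * B + R" "A \<in> forms d" "B \<in> forms d" "R \<in> forms (2 * d)"
    "\<And>a b c. cf R (a, b, c) \<noteq> 0 \<Longrightarrow> a < d \<and> b < d"
  using assms unfolding divisible_def by blast

lemma subspace_divisible: "poly3.subspace divisible"
  unfolding poly3.subspace_def
proof (intro conjI ballI allI)
  show "0 \<in> divisible"
    by (rule divisible_I[of _ 0 0 0]) simp_all
  fix p q :: "real poly3" and r :: real
  assume "p \<in> divisible"
  then obtain A B R where p: "p = FX * A + FY * B + R" "A \<in> forms d" "B \<in> forms d" "R \<in> forms (2 * d)"
     "\<And>a b c. cf R (a, b, c) \<noteq> 0 \<Longrightarrow> a < d \<and> b < d" by (rule divisible_E) blast
  show "smul r p \<in> divisible"
  proof (rule divisible_I)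
    show "smul r p = FX * smul r A + FY * smul r B + smul r R"
      by (simp add: p(1) poly3.scale_right_distrib smul_mult_right)
    show "a < d \<and> b < d" if "cf (smul r R) (a, b, c) \<noteq> 0" for a b c
      using that by (intro p(5)[of a b c]) simp
  qed (intro forms_smul p)+
  assume "q \<in> divisible"
  then obtain A' B' R' where q: "q = FX * A' + FY * B' + R'" "A' \<in> forms d" "B' \<in> forms d" "R' \<in> forms (2 * d)"
     "\<And>a b c. cf R' (a, b, c) \<noteq> 0 \<Longrightarrow> a < d \<and> b < d" by (rule divisible_E) blast
  show "p + q \<in> divisible"
  proof (rule divisible_I)
    show "p + q = FX * (A + A') + FY * (B + B') + (R + R')"
      by (simp add: p(1) q(1) algebra_simps)
    show "a < d \<and> b < d" if "cf (R + R') (a, b, c) \<noteq> 0" for a b c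
      using that p(5)[of a b c] q(5)[of a b c] by (cases "cf R (a, b, c) = 0") (simp_all add: lookup_add)
  qed (intro forms_add p q)+
qed

lemma divisible_keys:
  assumes "\<And>k. cf p k \<noteq> 0 \<Longrightarrow> mon k \<in> divisible"
  shows "p \<in> divisible"
proof -
  have "p = (\<Sum>k\<in>Poly_Mapping.keys p. smul (cf p k) (mon k))"
    by (intro poly3_expand) auto
  also have "\<dots> \<in> divisible"
    using assms by (intro poly3.subspace_sum poly3.subspace_scale subspace_divisible) (auto simp: in_keys_iff)
  finally show ?thesis .
qed

lemma divisible_mult: "A \<in> forms d \<Longrightarrow> FX * A \<in> divisible" "A \<in> forms d \<Longrightarrow> FY * A \<in> divisible"
proof -
  assume "A \<in> forms d"
  then show "FX * A \<in> divisible" "FY * A \<in> divisible"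
    using divisible_I[of "FX * A" A 0 0] divisible_I[of "FY * A" 0 A 0] by simp_all
qed

text \<open>Modulo \<open>FX\<close> the power \<open>x^d\<close> is replaced by terms of lower
  degree in \<open>x\<close> filled up with \<open>z\<close>, and likewise \<open>y^d\<close> modulo
  \<open>FY\<close>. Each replacement lowers the sum of the \<open>x\<close>- and
  \<open>y\<close>-exponents.\<close>

lemma mon_divisible: "k \<in> exps (2 * d) \<Longrightarrow> mon k \<in> divisible"
proof (induction "fst k + fst (snd k)" arbitrary: k rule: less_induct)
  case less
  obtain a b c where k: "k = (a, b, c)" by (cases k)
  have s: "a + b + c = 2 * d" using less.prems by (simp add: exps_def k)
  consider "a \<ge> d" | "b \<ge> d" | "a < d" "b < d" by linarith
  then show ?case
  proof cases
    case 1
    let ?R = "FX - mon (d, 0, 0)" and ?A = "mon (a - d, b, c) :: real poly3"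
    have "?R * ?A \<in> divisible"
    proof (rule divisible_keys)
      fix j assume "cf (?R * ?A) j \<noteq> 0"
      then have "j \<in> Poly_Mapping.keys (?R * ?A)" by (simp add: in_keys_iff)
      then obtain j' where j: "j = j' + (a - d, b, c)" "cf ?R j' \<noteq> 0"
        using keys_mult[of ?R ?A] by (auto simp: in_keys_iff)
      moreover have "\<exists>a<card X. \<exists>c. j' = (a, 0, 0) + (0, 0, c)"
        by (rule prod_keys[OF finite_X, of "\<lambda>x. lf 1 0 (- x)" "\<lambda>n. (n, 0, 0)" uminus])
          (use j(2) in \<open>simp_all add: FX_def card_X lf_def zero_prod_def\<close>)
      moreover have "?R \<in> forms d"
        by (intro forms_diff FX_forms forms_single) simp
      then have "tdeg j' = d" using j(2) unfolding forms_iff by blast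
      ultimately show "mon j \<in> divisible"
        using 1 s by (intro less.hyps) (auto simp: k exps_def card_X)
    qed
    moreover have "FX * ?A \<in> divisible"
      using 1 s by (intro divisible_mult forms_single) simp
    moreover have "mon k = FX * ?A - ?R * ?A"
      using 1 by (simp add: k algebra_simps mult_single)
    ultimately show ?thesis
      using poly3.subspace_diff[OF subspace_divisible] by simp
  next
    case 2
    let ?R = "FY - mon (0, d, 0)" and ?A = "mon (a, b - d, c) :: real poly3"
    have "?R * ?A \<in> divisible"
    proof (rule divisible_keys)
      fix j assume "cf (?R * ?A) j \<noteq> 0"
      then have "j \<in> Poly_Mapping.keys (?R * ?A)" by (simp add: in_keys_iff)
      then obtain j' where j: "j = j' + (a, b - d, c)" "cf ?R j' \<noteq> 0"
        using keys_mult[of ?R ?A] by (auto simp: in_keys_iff)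
      moreover have "\<exists>a<card X. \<exists>c. j' = (0, a, 0) + (0, 0, c)"
        by (rule prod_keys[OF finite_X, of "\<lambda>x. lf 0 1 (- x)" "\<lambda>n. (0, n, 0)" uminus])
          (use j(2) in \<open>simp_all add: FY_def card_X lf_def zero_prod_def\<close>)
      moreover have "?R \<in> forms d"
        by (intro forms_diff FY_forms forms_single) simp
      then have "tdeg j' = d" using j(2) unfolding forms_iff by blast
      ultimately show "mon j \<in> divisible"
        using 2 s by (intro less.hyps) (auto simp: k exps_def card_X)
    qed
    moreover have "FY * ?A \<in> divisible"
      using 2 s by (intro divisible_mult forms_single) simp
    moreover have "mon k = FY * ?A - ?R * ?A"
      using 2 by (simp add: k algebra_simps mult_single)
    ultimately show ?thesis
      using poly3.subspace_diff[OF subspace_divisible] by simp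
  next
    case 3
    then show ?thesis
      using s by (intro divisible_I[of _ 0 0 "mon k"]) (auto simp: k lookup_single when_def intro: forms_single split: if_splits)
  qed
qed

text \<open>The remainder of the division vanishes on the grid as well, so it is 0 by
  \<open>reduced_vanish\<close>.\<close>

lemma vanish_grid_ideal:
  assumes g: "g \<in> forms (2 * d)" and van: "\<And>P. P \<in> grid \<Longrightarrow> ev P g = 0"
  shows "\<exists>A\<in>forms d. \<exists>B\<in>forms d. g = FX * A + FY * B"
proof -
  have "g \<in> divisible"
  proof (rule divisible_keys)
    fix k assume "cf g k \<noteq> 0"
    with g have "k \<in> exps (2 * d)" unfolding forms_iff exps_def by blast
    then show "mon k \<in> divisible" by (rule mon_divisible)
  qed
  then obtain A B R where ABR: "g = FX * A + FY * B + R" "A \<in> forms d" "B \<in> forms d" "R \<in> forms (2 * d)"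
     "\<And>a b c. cf R (a, b, c) \<noteq> 0 \<Longrightarrow> a < d \<and> b < d" by (rule divisible_E) blast
  have "R = 0"
  proof (rule reduced_vanish[OF ABR(4,5)])
    fix P assume "P \<in> grid"
    with van[OF this] show "ev P R = 0"
      by (simp add: ABR(1) ev_add ev_mult FX_grid FY_grid)
  qed
  then show ?thesis using ABR by auto
qed

section \<open>Functionals that annihilate the multiples of the kernel\<close>

lemma grid_interpolation:
  "\<exists>\<delta>. \<forall>P\<in>grid. \<delta> P \<in> forms (2 * d) \<and> (\<forall>Q\<in>grid. ev Q (\<delta> P) = (if P = Q then 1 else 0))"
proof (intro bchoice ballI)
  fix P assume "P \<in> grid"
  then obtain x y where P: "P = (x, y, 1)" "x \<in> X" "y \<in> X" by (auto simp: grid_def)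
  \<comment> \<open>The two products have total degree \<open>2 * d - 2\<close>; the factor
    \<open>z^2\<close> fills up the degree and is 1 on the grid.\<close>
  define D where "D = (\<Prod>u\<in>X - {x}. lf 1 0 (- u)) * (\<Prod>v\<in>X - {y}. lf 0 1 (- v)) * mon (0, 0, 2)"
  have evD: "ev (u, v, 1) D = (\<Prod>u'\<in>X - {x}. u - u') * (\<Prod>v'\<in>X - {y}. v - v')" for u v
    by (simp add: D_def ev_mult ev_prod ev_single)
  have nz: "ev P D \<noteq> 0"
    using finite_X by (auto simp: P evD)
  have z: "ev Q D = 0" if "Q \<in> grid" "Q \<noteq> P" for Q
    using that finite_X by (auto simp: P evD grid_def)
  have "D \<in> forms (card (X - {x}) + card (X - {y}) + 2)"
    unfolding D_def using finite_X by (intro forms_mult forms_prod forms_single) auto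
  moreover have "card (X - {x}) + card (X - {y}) + 2 = 2 * d"
    using P d4 by (simp add: card_X finite_X)
  ultimately have "D \<in> forms (2 * d)" by (simp only:)
  then show "\<exists>D. D \<in> forms (2 * d) \<and> (\<forall>Q\<in>grid. ev Q D = (if P = Q then 1 else 0))"
    using nz z by (intro exI[of _ "smul (1 / ev P D) D"]) (auto simp: ev_smul intro: forms_smul)
qed

text \<open>The criterion for extremality: the functionals whose bilinear form kills
  \<open>W\<close> lie on one line.\<close>

lemma extremal:
  assumes l: "l \<in> form_dual (2 * d)" and null: "\<And>f g. f \<in> W \<Longrightarrow> g \<in> forms d \<Longrightarrow> l (f * g) = 0"
  shows "\<exists>s. \<forall>g\<in>forms (2 * d). l g = s * \<Lambda> g"
proof -
  have vg: "l g = 0" if g: "g \<in> forms (2 * d)" "\<And>P. P \<in> grid \<Longrightarrow> ev P g = 0" for g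
  proof -
    obtain A B where AB: "A \<in> forms d" "B \<in> forms d" "g = FX * A + FY * B"
      using vanish_grid_ideal[OF g] by blast
    moreover have "FX * A \<in> forms (2 * d)" "FY * B \<in> forms (2 * d)"
      using forms_mult[OF FX_forms AB(1)] forms_mult[OF FY_forms AB(2)] by (simp_all add: mult_2)
    ultimately show ?thesis
      using l null[OF FX_W AB(1)] null[OF FY_W AB(2)] by (simp add: form_dual_def)
  qed
  obtain \<delta> where \<delta>: "\<And>P. P \<in> grid \<Longrightarrow> \<delta> P \<in> forms (2 * d)"
    "\<And>P Q. P \<in> grid \<Longrightarrow> Q \<in> grid \<Longrightarrow> ev Q (\<delta> P) = (if P = Q then 1 else 0)"
    using grid_interpolation by blast
  define \<alpha> where "\<alpha> P = l (\<delta> P)" for P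
  have lg: "l g = (\<Sum>P\<in>grid. ev P g * \<alpha> P)" if g: "g \<in> forms (2 * d)" for g
  proof -
    let ?h = "\<Sum>P\<in>grid. smul (ev P g) (\<delta> P)"
    have h: "?h \<in> forms (2 * d)" using \<delta> by (intro forms_sum forms_smul)
    have "l (g - ?h) = 0"
    proof (rule vg)
      show "g - ?h \<in> forms (2 * d)" using g h by (rule forms_diff)
      fix Q assume Q: "Q \<in> grid"
      then have "(\<Sum>P\<in>grid. ev P g * ev Q (\<delta> P)) = (\<Sum>P\<in>grid. if P = Q then ev P g else 0)"
        by (intro sum.cong) (auto simp: \<delta>)
      then show "ev Q (g - ?h) = 0" using Q by (simp add: ev_diff ev_sum ev_smul)
    qed
    moreover have "l g = l (g - ?h) + l ?h"
      using form_dual_add[OF l forms_diff[OF g h] h] by (simp only: diff_add_cancel)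
    ultimately show ?thesis
      using form_dual_sum[OF l \<delta>(1), of grid "\<lambda>P. P" "\<lambda>P. ev P g"] by (simp add: \<alpha>_def)
  qed
  have key: "(\<Sum>P\<in>grid. ev P f * ev P g * \<alpha> P) = 0" if "f \<in> W" "g \<in> forms d" for f g
    using null[OF that] lg[of "f * g"] forms_mult[OF W_forms[OF that(1)] that(2)]
    by (simp add: ev_mult mult_2)
  \<comment> \<open>The form \<open>e star\<close> vanishes on \<open>Z\<close> and at
    \<open>q0\<close>; pairing it with a form that vanishes at the other remaining grid points
    isolates \<open>\<alpha> P\<close>.\<close>
  have sep: "\<alpha> P = 0" if P: "P \<in> grid" "P \<notin> insert q0 Z" "ev P (e star) \<noteq> 0"
    and g: "g \<in> forms d" "ev P g \<noteq> 0" and oth: "\<And>Q. Q \<in> grid \<Longrightarrow> Q \<notin> insert q0 Z \<Longrightarrow> Q \<noteq> P \<Longrightarrow> ev Q g = 0" for P g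
  proof -
    have z: "ev Q (e star) * ev Q g * \<alpha> Q = 0" if "Q \<in> grid - {P}" for Q
      using that e_star_vanish[of Q] oth[of Q] by (cases "Q \<in> insert q0 Z") simp_all
    have "0 = (\<Sum>Q\<in>grid. ev Q (e star) * ev Q g * \<alpha> Q)"
      using key[OF e_special_W(1) g(1)] by simp
    also have "\<dots> = ev P (e star) * ev P g * \<alpha> P + (\<Sum>Q\<in>grid - {P}. ev Q (e star) * ev Q g * \<alpha> Q)"
      using P(1) by (rule sum.remove[OF finite_grid])
    also have "(\<Sum>Q\<in>grid - {P}. ev Q (e star) * ev Q g * \<alpha> Q) = 0"
      using z by (rule sum.neutral[OF ballI])
    finally show ?thesis using P(3) g(2) by simp
  qed
  have rest: "Q = star \<or> (\<exists>i j. Q = pt (i, j) \<and> i + j \<le> d - 3 \<and> (i, j) \<noteq> (0, 0))"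
    if "Q \<in> grid" "Q \<notin> insert q0 Z" for Q
  proof -
    have "Q = star \<or> Q \<in> T" "Q \<noteq> pt (0, 0)"
      using that by (auto simp: Z_def q0_def)
    moreover have "\<exists>i j. Q = pt (i, j) \<and> i + j \<le> d - 3" if "Q \<in> T"
      using that by (auto simp: T_def)
    ultimately show ?thesis
      by metis
  qed
  have "\<alpha> star = 0"
  proof (rule sep)
    \<comment> \<open>The vertical lines \<open>x = 0, ..., d - 3\<close> cover \<open>T\<close> and
      miss \<open>star\<close>.\<close>
    let ?g = "(\<Prod>a<d - 2. lf 1 0 (- real a)) * mon (0, 0, 2)"
    have "?g \<in> forms (card {..<d - 2} + 2)"
      by (intro forms_mult forms_prod forms_single) auto
    moreover have "card {..<d - 2} + 2 = d"
      using d4 by simp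
    ultimately show "?g \<in> forms d" by (simp only:)
    show "ev star ?g \<noteq> 0"
      using half_not_nat by (auto simp: star_def ev_mult ev_prod ev_single)
    show "ev Q ?g = 0" if H: "Q \<in> grid" "Q \<notin> insert q0 Z" "Q \<noteq> star" for Q
    proof -
      obtain i j where "Q = pt (i, j)" "i + j \<le> d - 3"
        using rest[OF H(1,2)] H(3) by blast
      then show ?thesis
        using d4 by (auto simp: pt_def ev_mult ev_prod ev_single)
    qed
    show "star \<in> grid" using star_grid by blast
    show "star \<notin> insert q0 Z" using special_base(4) star_neq_pt[of "(0, 0)"] by (simp add: q0_def)
    show "ev star (e star) \<noteq> 0" using ev_e[OF special_base(1) special_base(1)] by simp
  qed
  moreover have "\<alpha> (pt (i, j)) = 0" if ij: "i + j \<le> d - 3" "(i, j) \<noteq> (0, 0)" for i j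
  proof (rule sep)
    \<comment> \<open>\<open>L (i, j)\<close> removes the other points of \<open>T\<close>, and the
      line \<open>x = z/2\<close> removes \<open>star\<close>.\<close>
    let ?g = "L (i, j) * lf 1 0 (- 1/2) * mon (0, 0, 2)"
    have "?g \<in> forms (d - 3 + 1 + 2)"
      by (intro forms_mult L_forms ij forms_single) auto
    moreover have "d - 3 + 1 + 2 = d"
      using d4 by simp
    ultimately show "?g \<in> forms d" by (simp only:)
    show "ev (pt (i, j)) ?g \<noteq> 0"
      using half_not_nat[of i] L_self[OF ij(1)] by (auto simp: pt_def ev_mult ev_single)
    show "ev Q ?g = 0" if H: "Q \<in> grid" "Q \<notin> insert q0 Z" "Q \<noteq> pt (i, j)" for Q
      using rest[OF H(1,2)]
    proof
      assume "Q = star"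
      then show ?thesis by (simp add: ev_mult star_def)
    next
      assume "\<exists>i j. Q = pt (i, j) \<and> i + j \<le> d - 3 \<and> (i, j) \<noteq> (0, 0)"
      then obtain i' j' where Q: "Q = pt (i', j')" "i' + j' \<le> d - 3" by blast
      then have "(i', j') \<noteq> (i, j)" using H(3) by metis
      then show ?thesis using L_other[OF ij(1) Q(2)] by (simp add: ev_mult Q(1))
    qed
    have pT: "pt (i, j) \<in> T" using ij by (auto simp: T_def)
    then show "pt (i, j) \<in> grid" using T_subset by blast
    have "pt (i, j) \<noteq> q0" using ij(2) by (simp add: q0_def pt_def)
    with pT show "pt (i, j) \<notin> insert q0 Z" by (simp add: Z_def)
    show "ev (pt (i, j)) (e star) \<noteq> 0" using e_star_nonzero[OF ij] .
  qed
  ultimately have \<alpha>0: "\<alpha> Q = 0" if "Q \<in> grid" "Q \<notin> insert q0 Z" for Q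
    using rest[OF that] by blast
  have sub: "insert q0 Z \<subseteq> grid"
    using q0_T T_subset by (auto simp: Z_def)
  \<comment> \<open>The factor is read off at \<open>q0\<close>; the coefficients on
    \<open>Z\<close> must then agree with it.\<close>
  define s where "s = - \<alpha> q0 * M / (c q0)\<^sup>2"
  have \<alpha>q: "\<alpha> q0 = - s * (c q0)\<^sup>2 / M"
    using c_nonzero M_pos by (simp add: s_def)
  \<comment> \<open>In the pairing of \<open>fstar\<close> with \<open>e P\<close> only
    \<open>P\<close> and \<open>q0\<close> contribute, which ties \<open>\<alpha> P\<close> to
    \<open>\<alpha> q0\<close>.\<close>
  have \<alpha>Z: "\<alpha> P = s * (c P)\<^sup>2" if P: "P \<in> Z" for P
  proof -
    have Pb: "P \<in> base" using P Z_base by auto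
    have eZ: "ev Q (e P) = (if P = Q then 1 else 0)" if "Q \<in> Z" for Q
      using ev_e[OF Pb subsetD[OF Z_base that]] .
    have "c P = (\<Sum>Q\<in>Z. if Q = P then c Q else 0)"
      using P by simp
    also have "\<dots> = (\<Sum>Q\<in>Z. c Q * ev Q (e P))"
      by (intro sum.cong) (auto simp: eZ)
    also have "\<dots> = - c q0 * ev q0 (e P)"
      using Z_relation[OF e_forms[OF Pb]] .
    finally have cP: "ev q0 (e P) = - c P / c q0"
      using c_nonzero by (simp add: field_simps)
    have "0 = (\<Sum>Q\<in>grid. ev Q fstar * ev Q (e P) * \<alpha> Q)"
      using key[OF fstar_W e_forms[OF Pb]] by simp
    also have "\<dots> = (\<Sum>Q\<in>insert q0 Z. ev Q fstar * ev Q (e P) * \<alpha> Q)"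
      by (rule sum.mono_neutral_right[OF finite_grid sub]) (simp add: \<alpha>0)
    also have "\<dots> = ev q0 fstar * ev q0 (e P) * \<alpha> q0 + (\<Sum>Q\<in>Z. ev Q fstar * ev Q (e P) * \<alpha> Q)"
      by simp
    also have "(\<Sum>Q\<in>Z. ev Q fstar * ev Q (e P) * \<alpha> Q) = (\<Sum>Q\<in>Z. if Q = P then \<alpha> Q / c Q else 0)"
    proof (rule sum.cong[OF refl])
      fix Q assume "Q \<in> Z"
      then show "ev Q fstar * ev Q (e P) * \<alpha> Q = (if Q = P then \<alpha> Q / c Q else 0)"
        using ev_fstar[OF subsetD[OF Z_base]] eZ by simp
    qed
    also have "\<dots> = \<alpha> P / c P" using P by simp
    finally have "\<alpha> P / c P = - (ev q0 fstar * ev q0 (e P) * \<alpha> q0)" by simp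
    also have "\<dots> = s * c P"
      using c_nonzero M_pos by (simp add: ev_fstar_q0 cP s_def power2_eq_square)
    finally show ?thesis
      using c_nonzero(1)[OF P] by (simp add: field_simps power2_eq_square)
  qed
  have "l g = s * \<Lambda> g" if g: "g \<in> forms (2 * d)" for g
  proof -
    have "l g = (\<Sum>P\<in>insert q0 Z. ev P g * \<alpha> P)"
      unfolding lg[OF g] by (rule sum.mono_neutral_right[OF finite_grid sub]) (simp add: \<alpha>0)
    also have "\<dots> = ev q0 g * \<alpha> q0 + (\<Sum>P\<in>Z. s * ((c P)\<^sup>2 * ev P g))"
      by (simp add: \<alpha>Z mult_ac)
    also have "\<dots> = s * \<Lambda> g"
      by (simp add: \<alpha>q \<Lambda>_def sum_distrib_left algebra_simps)
    finally show ?thesis .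
  qed
  then show ?thesis by blast
qed

section \<open>The extreme ray\<close>

definition ell :: "real poly3 \<Rightarrow> real" where
  "ell p = (if p \<in> forms (2 * d) then \<Lambda> p else 0)"

lemma forms_mult_d: "f \<in> forms d \<Longrightarrow> g \<in> forms d \<Longrightarrow> f * g \<in> forms (2 * d)"
  using forms_mult[of f d g d] by (simp add: mult_2)

lemma ell_form_dual: "ell \<in> form_dual (2 * d)"
  by (simp add: form_dual_def ell_def forms_add forms_smul \<Lambda>_add \<Lambda>_smul)

lemma ell_sos_dual: "ell \<in> sos_dual d"
  using ell_form_dual \<Lambda>_nonneg by (simp add: sos_dual_def bilin_def ell_def forms_mult_d)

definition node :: "real \<times> real \<times> real" where
  "node = (1/2, 0, 1)"

text \<open>The values of \<open>e node\<close> weighted by \<open>c\<close> are not constant on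
  \<open>Z\<close>: nonzero at \<open>node\<close> and 0 at the other point of
  \<open>nodes_Z\<close>. So \<open>e node\<close> is outside the kernel.\<close>

lemma node: "node \<in> Z" "e node \<in> forms d" "\<Lambda> (e node * e node) > 0"
proof -
  have far: "(real (d - 2), 0, 1) \<noteq> node"
    using half_not_nat by (simp add: node_def)
  show Z: "node \<in> Z"
    using nodes_Z by (simp add: node_def)
  then show f: "e node \<in> forms d"
    using Z_base by (intro e_forms) auto
  have "e node \<notin> W"
  proof
    assume "e node \<in> W"
    then obtain t where t: "\<And>P. P \<in> Z \<Longrightarrow> c P * ev P (e node) = t"
      unfolding W_def by blast
    have "ev node (e node) = 1" "ev (real (d - 2), 0, 1) (e node) = 0"
      using ev_e[OF subsetD[OF Z_base Z] subsetD[OF Z_base Z]]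
        ev_e[OF subsetD[OF Z_base Z] subsetD[OF Z_base nodes_Z(1)]] far by simp_all
    then show False
      using t[OF Z] t[OF nodes_Z(1)] c_nonzero(1)[OF Z] by simp
  qed
  then show "\<Lambda> (e node * e node) > 0"
    using \<Lambda>_nonneg[OF f] W_I[OF f] by force
qed

lemma ell_node: "ell (e node * e node) > 0"
  using node by (simp add: ell_def forms_mult_d)

text \<open>On squares of kernel forms both summands are nonnegative with sum 0, so the bilinear
  form of \<open>a\<close> kills \<open>W\<close> by \<open>sos_dual_null\<close>. Then
  \<open>extremal\<close> makes \<open>a\<close> a multiple of \<open>ell\<close>, and the square of
  \<open>e node\<close> fixes the sign.\<close>

lemma ell_face:
  assumes a: "a \<in> sos_dual d" and b: "b \<in> sos_dual d" and u: "0 < u" "u < 1"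
    and x: "(1 - u) *\<^sub>R a + u *\<^sub>R b \<in> ray ell"
  shows "a \<in> ray ell"
proof -
  obtain t where t: "(1 - u) *\<^sub>R a + u *\<^sub>R b = t *\<^sub>R ell"
    using x by (auto simp: ray_def)
  have tp: "(1 - u) * a p + u * b p = t * ell p" for p
    using fun_cong[OF t, of p] by (simp add: scaleR_fun_def)
  have ad: "a \<in> form_dual (2 * d)" and apos: "\<And>h. h \<in> forms d \<Longrightarrow> a (h * h) \<ge> 0"
    and bpos: "\<And>h. h \<in> forms d \<Longrightarrow> b (h * h) \<ge> 0"
    using a b by (auto simp: sos_dual_def bilin_def)
  have "a (f * g) = 0" if f: "f \<in> W" and g: "g \<in> forms d" for f g
  proof -
    have "ell (f * f) = 0"
      using W_null[OF f W_forms[OF f]] by (simp add: ell_def)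
    then have "(1 - u) * a (f * f) + u * b (f * f) = 0"
      using tp by simp
    moreover have "(1 - u) * a (f * f) \<ge> 0" "u * b (f * f) \<ge> 0"
      using apos bpos W_forms[OF f] u by simp_all
    ultimately have "(1 - u) * a (f * f) = 0" by linarith
    then have "a (f * f) = 0" using u by simp
    then show ?thesis
      using sos_dual_null[OF a W_forms[OF f] g] by blast
  qed
  then obtain s where s: "\<And>g. g \<in> forms (2 * d) \<Longrightarrow> a g = s * \<Lambda> g"
    using extremal[OF ad] by blast
  have as: "a = s *\<^sub>R ell"
  proof
    fix p show "a p = (s *\<^sub>R ell) p"
      using s[of p] ad by (simp add: scaleR_fun_def ell_def form_dual_def)
  qed
  have "0 \<le> s * ell (e node * e node)"
    using apos[OF node(2)] as by (simp add: scaleR_fun_def)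
  then have "s \<ge> 0"
    using ell_node by (simp add: zero_le_mult_iff)
  then show ?thesis
    using as by (auto simp: ray_def)
qed

lemma ell_extreme: "spans_extreme_ray ell (sos_dual d)"
  unfolding spans_extreme_ray_def face_of_def
proof (intro conjI ballI impI)
  show "ell \<noteq> 0"
    using ell_node by auto
  show "ray ell \<subseteq> sos_dual d"
  proof
    fix x assume "x \<in> ray ell"
    then obtain r where r: "r \<ge> 0" "x = r *\<^sub>R ell" by (auto simp: ray_def)
    have "x \<in> form_dual (2 * d)"
      using ell_form_dual by (simp add: r form_dual_def scaleR_fun_def algebra_simps)
    moreover have "bilin x f f \<ge> 0" if "f \<in> forms d" for f
      using ell_sos_dual r that by (simp add: sos_dual_def bilin_def scaleR_fun_def)
    ultimately show "x \<in> sos_dual d" by (simp add: sos_dual_def)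
  qed
  show "convex (ray ell)"
  proof (rule convexI)
    fix x y :: "real poly3 \<Rightarrow> real" and u v :: real
    assume "x \<in> ray ell" "y \<in> ray ell" and uv: "0 \<le> u" "0 \<le> v"
    then obtain r s where "r \<ge> 0" "x = r *\<^sub>R ell" "s \<ge> 0" "y = s *\<^sub>R ell" by (auto simp: ray_def)
    then have "u *\<^sub>R x + v *\<^sub>R y = (u * r + v * s) *\<^sub>R ell" "u * r + v * s \<ge> 0"
      using uv by (simp_all add: scaleR_add_left)
    then show "u *\<^sub>R x + v *\<^sub>R y \<in> ray ell" unfolding ray_def by blast
  qed
  fix a b x assume a: "a \<in> sos_dual d" and b: "b \<in> sos_dual d" and x: "x \<in> ray ell" "x \<in> open_segment a b"
  then obtain u where u: "0 < u" "u < 1" "x = (1 - u) *\<^sub>R a + u *\<^sub>R b"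
    by (auto simp: in_segment)
  show "a \<in> ray ell"
    using ell_face[OF a b u(1,2)] x u by simp
  show "b \<in> ray ell"
    using ell_face[OF b a, of "1 - u"] x u by (simp add: add.commute)
qed

subsection \<open>Corank and Hilbert function\<close>

definition W_basis :: "real poly3 set" where
  "W_basis = {fstar, e star, e (1, 0, 0), e (0, 1, 0)}"

text \<open>Evaluation at \<open>node\<close>, at \<open>star\<close> and at the two points at
  infinity isolates the four coefficients in turn.\<close>

lemma W_basis_combination:
  fixes r1 r2 r3 r4 :: real
  assumes "smul r1 fstar + smul r2 (e star) + smul r3 (e (1, 0, 0)) + smul r4 (e (0, 1, 0)) = 0"
  shows "r1 = 0 \<and> r2 = 0 \<and> r3 = 0 \<and> r4 = 0"
proof -
  have b: "node \<in> base" using node Z_base by auto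
  have *: "r1 * ev Q fstar + r2 * ev Q (e star) + r3 * ev Q (e (1, 0, 0)) + r4 * ev Q (e (0, 1, 0)) = 0" for Q
    using arg_cong[OF assms, of "ev Q"] by (simp add: ev_add ev_smul ev_0)
  have nn: "node \<noteq> star" "node \<noteq> (1, 0, 0)" "node \<noteq> (0, 1, 0)"
    using node(1) special_base by metis+
  have "r1 = 0"
    using *[of node] node(1) b nn special_base c_nonzero(1)[OF node(1)]
    by (simp add: ev_fstar ev_e)
  moreover have "r2 = 0"
    using *[of star] special_base by (simp add: ev_fstar ev_e)
  moreover have "r3 = 0"
    using *[of "(1, 0, 0)"] special_base by (simp add: ev_fstar ev_e)
  moreover have "r4 = 0"
    using *[of "(0, 1, 0)"] special_base by (simp add: ev_fstar ev_e)
  ultimately show ?thesis by blast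
qed

lemma W_basis_distinct: "distinct [fstar, e star, e (1, 0, 0), e (0, 1, 0)]"
  using W_basis_combination[of 1 "-1" 0 0] W_basis_combination[of 1 0 "-1" 0] W_basis_combination[of 1 0 0 "-1"]
    W_basis_combination[of 0 1 "-1" 0] W_basis_combination[of 0 1 0 "-1"] W_basis_combination[of 0 0 1 "-1"]
  by auto

lemma card_W_basis: "card W_basis = 4" and finite_W_basis: "finite W_basis"
  using distinct_card[OF W_basis_distinct] by (simp_all add: W_basis_def)

lemma independent_W_basis: "poly3.independent W_basis"
proof (rule poly3.independent_if_scalars_zero)
  fix r x assume "(\<Sum>x\<in>W_basis. smul (r x) x) = 0" and x: "x \<in> W_basis"
  then have "smul (r fstar) fstar + smul (r (e star)) (e star) + smul (r (e (1, 0, 0))) (e (1, 0, 0))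
      + smul (r (e (0, 1, 0))) (e (0, 1, 0)) = 0"
    using W_basis_distinct by (simp add: W_basis_def add.assoc)
  from W_basis_combination[OF this] show "r x = 0"
    using x by (auto simp: W_basis_def)
qed (rule finite_W_basis)

lemma subspace_W: "poly3.subspace W"
proof (rule poly3.subspaceI)
  show "0 \<in> W"
    by (simp add: W_iff \<Lambda>_def ev_0)
  show "x + y \<in> W" if "x \<in> W" "y \<in> W" for x y
    using that by (simp add: W_iff forms_add distrib_right \<Lambda>_add)
  show "smul r x \<in> W" if "x \<in> W" for r x
    using that by (simp add: W_iff forms_smul smul_mult_left \<Lambda>_smul)
qed

lemma span_W_basis: "poly3.span W_basis = W"
proof
  show "poly3.span W_basis \<subseteq> W"
    using fstar_W e_special_W by (intro poly3.span_minimal subspace_W) (auto simp: W_basis_def)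
  show "W \<subseteq> poly3.span W_basis"
  proof
    fix f assume "f \<in> W"
    from W_expand[OF this] obtain t where f: "f = smul t fstar + smul (ev star f) (e star)
      + smul (ev (1, 0, 0) f) (e (1, 0, 0)) + smul (ev (0, 1, 0) f) (e (0, 1, 0))" ..
    have "smul t fstar + smul (ev star f) (e star)
      + smul (ev (1, 0, 0) f) (e (1, 0, 0)) + smul (ev (0, 1, 0) f) (e (0, 1, 0)) \<in> poly3.span W_basis"
      by (intro poly3.span_add poly3.span_scale poly3.span_base) (auto simp: W_basis_def)
    then show "f \<in> poly3.span W_basis" using f by simp
  qed
qed

lemma ell_corank: "corank d ell = 4"
proof -
  define B where "B f = (\<lambda>g. if g \<in> forms d then \<Lambda> (f * g) else 0)" for f
  have "Vector_Spaces.linear smul scaleR B"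
    by unfold_locales
      (auto simp: B_def scaleR_fun_def fun_eq_iff distrib_right smul_mult_left \<Lambda>_add \<Lambda>_smul)
  moreover have "poly3.span W_basis = {f \<in> forms d. B f = 0}"
    unfolding span_W_basis by (auto simp: W_iff B_def fun_eq_iff)
  ultimately have "dim (B ` forms d) = ((d + 2) choose 2) - 4"
    using rank_nullity_forms[of B W_basis d] independent_W_basis by (simp add: card_W_basis)
  moreover have "(\<lambda>f g. if g \<in> forms d then bilin ell f g else 0) ` forms d = B ` forms d"
    by (intro image_cong refl) (auto simp: B_def bilin_def ell_def forms_mult_d)
  \<comment> \<open>Subtracting twice gives back 4 only if the truncated subtraction does not cut
    off.\<close>
  moreover have "4 \<le> (d + 2) choose 2"
    using independent_forms_card[OF independent_W_basis, of d] span_W_basis poly3.span_superset[of W_basis] W_forms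
    by (auto simp: card_W_basis)
  ultimately show ?thesis
    by (simp add: corank_def bilin_rank_def)
qed

text \<open>
  Multiplying \<open>p\<close> up to degree \<open>d - 1\<close> and then by \<open>x\<close> and by \<open>z\<close> gives two kernel forms. Both
  are constant on \<open>Z\<close> after scaling by \<open>c\<close>, but \<open>x/z\<close> is not, so they vanish on \<open>Z\<close>.
\<close>

lemma low_degree:
  assumes p: "p \<in> forms j" "j < d" and null: "\<And>q. q \<in> forms (2 * d - j) \<Longrightarrow> \<Lambda> (p * q) = 0"
  shows "p = 0"
proof -
  define p' where "p' = p * mon (0, 0, d - 1 - j)"
  have "p' \<in> forms (j + (d - 1 - j))"
    unfolding p'_def by (intro forms_mult p(1) forms_single) simp
  then have p': "p' \<in> forms (d - 1)" using p(2) by simp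
  have pm: "p' * m \<in> forms d" if "m \<in> forms 1" for m
    using forms_mult[OF p' that] d4 by simp
  have pW: "p' * m \<in> W" if m: "m \<in> forms 1" for m
    unfolding W_iff
  proof (intro conjI ballI pm m)
    fix g :: "real poly3" assume g: "g \<in> forms d"
    have "mon (0, 0, d - 1 - j) * (m * g) \<in> forms ((d - 1 - j) + (1 + d))"
      by (intro forms_mult m g forms_single) simp
    moreover have "(d - 1 - j) + (1 + d) = 2 * d - j" using p(2) by simp
    ultimately have "\<Lambda> (p * (mon (0, 0, d - 1 - j) * (m * g))) = 0"
      using null by metis
    then show "\<Lambda> (p' * m * g) = 0" by (simp add: p'_def mult.assoc)
  qed
  obtain t where t: "\<And>P. P \<in> Z \<Longrightarrow> c P * ev P (p' * lf 0 0 1) = t"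
    using pW[of "lf 0 0 1"] unfolding W_def by auto
  obtain s where s: "\<And>P. P \<in> Z \<Longrightarrow> c P * ev P (p' * lf 1 0 0) = s"
    using pW[of "lf 1 0 0"] unfolding W_def by auto
  have "t * real (d - 2) = s"
    using t[OF nodes_Z(1)] s[OF nodes_Z(1)] by (simp add: ev_mult algebra_simps del: of_nat_diff)
  moreover have "t * (1/2) = s"
    using t[OF nodes_Z(2)] s[OF nodes_Z(2)] by (simp add: ev_mult algebra_simps)
  ultimately have "t * (1/2 - real (d - 2)) = 0"
    by (simp add: algebra_simps)
  then have t0: "t = 0"
    using half_not_nat(2)[of "d - 2"] mult_eq_0_iff by blast
  have gz: "\<exists>x y. P = (x, y, 1)" if "P \<in> grid" for P
    using that by (auto simp: grid_def)
  have Zg: "P \<in> grid" if "P \<in> Z" for P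
    using that by (simp add: Z_def)
  have vZ: "ev P p' = 0" if "P \<in> Z" for P
    using t[OF that] t0 c_nonzero(1)[OF that] gz[OF Zg[OF that]] by (auto simp: ev_mult)
  have v0: "ev q0 p' = 0"
    using vanish_q0[OF pm[of "lf 0 0 1"]] vZ by (simp add: ev_mult q0_def pt_def)
  \<comment> \<open>The factor \<open>2x - z\<close> vanishes at \<open>star\<close>, so the product
    vanishes on the grid outside \<open>T\<close> and hence on the grid; at \<open>pt (1, 0)\<close>
    the factor is 1.\<close>
  have v10: "ev (pt (1, 0)) p' = 0"
  proof -
    have "ev P (p' * lf 2 0 (-1)) = 0" if "P \<in> grid - T" for P
      using that vZ[of P] by (cases "P = star") (simp_all add: ev_mult star_def Z_def)
    moreover have "pt (1, 0) \<in> grid"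
      using T_subset d4 unfolding T_def by (force simp del: One_nat_def)
    ultimately have "ev (pt (1, 0)) (p' * lf 2 0 (-1)) = 0"
      using vanish_grid[OF pm[of "lf 2 0 (-1)"] order_refl] by (metis lf_forms(1))
    then show ?thesis by (simp add: ev_mult pt_def)
  qed
  \<comment> \<open>The zero at \<open>pt (1, 0)\<close> is carried to \<open>star\<close> by
    \<open>L_times_vanish\<close>, since \<open>L (1, 0)\<close> is nonzero there.\<close>
  have vstar: "ev star p' = 0"
  proof -
    have le: "1 + 0 \<le> d - 3" "(1::nat, 0::nat) \<noteq> (0, 0)" "d - 1 \<le> d" using d4 by auto
    have "ev P p' = 0" if "P \<in> insert q0 Z" for P
      using that v0 vZ by blast
    from L_times_vanish[OF p' le(3,1) this le(2)]
    have "w star * ev star p' * ev star (L (1, 0)) = 0"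
      by (simp only: v10 mult_zero_right mult_zero_left add_0)
    then show ?thesis
      using L_star[OF le(1)] w_nonzero[of star] star_grid by auto
  qed
  show "p = 0"
  proof (rule reduced_vanish[OF p(1)])
    show "a < d \<and> b < d" if "cf p (a, b, c) \<noteq> 0" for a b c
      using p that unfolding forms_iff by force
    fix P assume P: "P \<in> grid"
    have "ev Q p' = 0" if "Q \<in> grid - T" for Q
      using that vZ[of Q] vstar by (cases "Q = star") (simp_all add: Z_def)
    then have "ev P p' = 0"
      using vanish_grid[OF p' _ _ P] by simp
    then show "ev P p = 0"
      using gz[OF P] by (auto simp: p'_def ev_mult ev_single)
  qed
qed

section \<open>The Gorenstein ideal and its Hilbert function\<close>

text \<open>The value 0 outside degree \<open>2 * d\<close> is what \<open>gorenstein_iff\<close>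
  asks of a functional on all polynomials.\<close>

definition \<phi> :: "nat \<times> nat \<times> nat \<Rightarrow> real" where
  "\<phi> k = (if tdeg k = 2 * d then \<Lambda> (mon k) else 0)"

lemma \<Lambda>_Lin:
  assumes "p \<in> forms (2 * d)" shows "\<Lambda> p = Lin \<phi> p"
proof -
  have \<Lambda>_sum: "\<Lambda> (sum f I) = (\<Sum>i\<in>I. \<Lambda> (f i))" for f and I :: "(nat \<times> nat \<times> nat) set"
    by (induction I rule: infinite_finite_induct) (simp_all add: \<Lambda>_add \<Lambda>_def[of 0] ev_0)
  have "p = (\<Sum>k\<in>exps (2 * d). smul (cf p k) (mon k))"
    using assms by (intro poly3_expand) (simp_all add: keys_forms)
  then have "\<Lambda> p = (\<Sum>k\<in>exps (2 * d). cf p k * \<Lambda> (mon k))"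
    by (metis (no_types, lifting) \<Lambda>_smul \<Lambda>_sum sum.cong)
  also have "\<dots> = (\<Sum>k\<in>exps (2 * d). cf p k * \<phi> k)"
    by (intro sum.cong) (auto simp: exps_def \<phi>_def)
  also have "\<dots> = Lin \<phi> p"
    using assms by (intro Lin_superset[symmetric]) (simp_all add: keys_forms)
  finally show ?thesis .
qed

lemma complexify_Lin:
  assumes "p \<in> forms (2 * d)"
  shows "complexify ell p = Lin (\<lambda>k. complex_of_real (\<phi> k)) p"
proof -
  have "Lin (\<lambda>k. complex_of_real (\<phi> k)) p = complex_of_real (Lin \<phi> (reP p)) + \<i> * complex_of_real (Lin \<phi> (imP p))"
    by (subst complex_split[of p]) (simp add: Lin_add Lin_smul Lin_ofP)
  then show ?thesis
    using assms by (simp add: complexify_def ell_def forms_map \<Lambda>_Lin complex_eq_iff)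
qed

abbreviation G :: "complex poly3 set" where
  "G \<equiv> gorenstein_ideal (2 * d) (complexify ell)"

lemma gorenstein_iff_parts:
  assumes "p \<in> forms i" "i \<le> 2 * d"
  shows "p \<in> G \<longleftrightarrow> (\<forall>q\<in>forms (2 * d - i). \<Lambda> (reP p * q) = 0) \<and> (\<forall>q\<in>forms (2 * d - i). \<Lambda> (imP p * q) = 0)"
proof -
  have "p \<in> G \<longleftrightarrow> (\<forall>q\<in>forms (2 * d - i). Lin (\<lambda>k. complex_of_real (\<phi> k)) (p * q) = 0)"
    using complexify_Lin assms by (intro gorenstein_iff) (auto simp: \<phi>_def)
  also have "\<dots> \<longleftrightarrow> (\<forall>q\<in>forms (2 * d - i). Lin \<phi> (reP p * q) = 0) \<and> (\<forall>q\<in>forms (2 * d - i). Lin \<phi> (imP p * q) = 0)"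
    by (rule Lin_complex_orthogonal)
  also have "\<dots> \<longleftrightarrow> (\<forall>q\<in>forms (2 * d - i). \<Lambda> (reP p * q) = 0) \<and> (\<forall>q\<in>forms (2 * d - i). \<Lambda> (imP p * q) = 0)"
  proof -
    have "f * q \<in> forms (2 * d)" if "f \<in> forms i" "q \<in> forms (2 * d - i)" for f q :: "real poly3"
      using forms_mult[OF that] assms by simp
    then show ?thesis
      using forms_map(1,2)[OF assms(1)] \<Lambda>_Lin by metis
  qed
  finally show ?thesis .
qed

lemma Hilb_low:
  assumes "j < d"
  shows "Hilb G j = (j + 2) choose 2"
proof -
  have "G \<inter> forms j = {0}"
  proof (intro set_eqI iffI)
    fix p assume p: "p \<in> G \<inter> forms j"
    then have "reP p = 0" "imP p = 0"
      using gorenstein_iff_parts[of p j] assms low_degree[of "reP p" j] low_degree[of "imP p" j]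
      by (auto simp: forms_map)
    then have "p = 0"
      using complex_split[of p] by (simp add: ofP_0)
    then show "p \<in> {0}" by simp
  next
    fix p :: "complex poly3" assume "p \<in> {0}"
    then show "p \<in> G \<inter> forms j"
      using poly3.subspace_0[OF subspace_gorenstein] by simp
  qed
  then have "poly3.span {} = G \<inter> forms j"
    by simp
  from Hilb_eq[OF subspace_gorenstein poly3.independent_empty this] show ?thesis
    by simp
qed

text \<open>In degree \<open>d\<close> the ideal is the complexification of the kernel
  \<open>W\<close>, which has dimension 4.\<close>

lemma Hilb_middle: "Hilb G d = ((d + 2) choose 2) - 4"
proof -
  have "poly3.span (ofP ` W_basis) = G \<inter> forms d"
    unfolding complexify_span(3)[OF independent_W_basis finite_W_basis] span_W_basis
  proof (intro set_eqI iffI)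
    fix p assume "p \<in> {p. reP p \<in> W \<and> imP p \<in> W}"
    then have W: "reP p \<in> W" "imP p \<in> W" by auto
    then have "ofP (reP p) + smul \<i> (ofP (imP p)) \<in> forms d"
      by (intro forms_add forms_smul forms_map W_forms)
    then have "p \<in> forms d" using complex_split[of p] by simp
    then show "p \<in> G \<inter> forms d"
      using gorenstein_iff_parts[of p d] W by (simp add: W_iff)
  next
    fix p assume "p \<in> G \<inter> forms d"
    then show "p \<in> {p. reP p \<in> W \<and> imP p \<in> W}"
      using gorenstein_iff_parts[of p d] by (simp add: W_iff forms_map)
  qed
  then show ?thesis
    using Hilb_eq[OF subspace_gorenstein complexify_span(1)[OF independent_W_basis finite_W_basis]]
    by (simp add: complexify_span(2)[OF independent_W_basis finite_W_basis] card_W_basis)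
qed

end

theorem lemma2p13:
  fixes d :: nat
  assumes "d \<ge> 4"
  shows "\<exists>l. spans_extreme_ray l (sos_dual d) \<and> corank d l = 4 \<and>
    (\<forall>j<d. Hilb (gorenstein_ideal (2 * d) (complexify l)) j = (j + 2) choose 2) \<and>
    Hilb (gorenstein_ideal (2 * d) (complexify l)) d = ((d + 2) choose 2) - 4"
proof -
  interpret grid_config d
    using assms by unfold_locales
  show ?thesis
    using ell_extreme ell_corank Hilb_low Hilb_middle by blast
qed

end
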